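(* Let $(\mathcal{H},\mathcal{A},\tau)$ be a quantum Markov semigroup, and let $\circ$ denote the extended Choi–Effros product on $\mathcal{P}(\tau)$. Then for $a,b\in\mathbb{R}$, $x\in E_a(\tau)$ and $y\in E_b(\tau)$, $$x\circ y=\mathrm{s.}\lim_{t\to\infty}\frac{\tau_t(xy)}{\exp(iat)\exp(ibt)},$$ where the limit is in the strong operator topology.
   Context: Semigroups. A quantum dynamical semigroup is a triple $(\mathcal{H},\mathcal{A},\tau)$ with $\mathcal{H}$ a complex separable Hilbert space, $\mathcal{A}\subseteq\mathscr{B}(\mathcal{H})$ a von Neumann algebra, and $\tau=\{\tau_t:t\in\mathbb{R}_+\}$ a family of normal completely positive linear maps on $\mathcal{A}$ with $\tau_0=\mathrm{id}$, $\tau_s\circ\tau_t=\tau_{s+t}$, $\tau_t(1)\le 1$ for all $s,t$, and $t\mapsto\tau_t(x)$ strongly continuous for each $x\in\mathcal{A}$. It is a quantum Markov semigroup if $\tau_t(1)=1$ for all $t$, and an $E$-semigroup if every $\tau_t$ is a $*$-endomorphism. Minimal dilation. For a Hilbert space $\mathcal{K}\supseteq\mathcal{H}$ with projection $p$ onto $\mathcal{H}$, operators $x\in\mathscr{B}(\mathcal{H})$ are identified with $pxp\in\mathscr{B}(\mathcal{K})$. The minimal dilation of $(\mathcal{H},\mathcal{A},\tau)$, known to exist and to be unique up to unitary equivalence, is an $E$-semigroup $(\mathcal{K},\mathcal{B},\theta)$ with: $\mathcal{K}\supseteq\mathcal{H}$; $\mathcal{B}\subseteq\mathscr{B}(\mathcal{K})$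 a von Neumann algebra with $p\mathcal{B}p=\mathcal{A}$; $\tau_t(x)=p\theta_t(x)p$ for all $x\in\mathcal{A}$, $t\ge 0$; $\mathcal{K}=\overline{\mathrm{span}}\{\theta_{r_1}(x_1)\cdots\theta_{r_n}(x_n)u: r_1>r_2>\cdots>r_n\ge 0,\ x_i\in\mathcal{A},\ u\in\mathcal{H}\}$; and $\mathcal{B}$ is generated as a von Neumann algebra by $\{\theta_t(x):t\in\mathbb{R}_+,x\in\mathcal{A}\}$. When $\tau$ is a quantum Markov semigroup, $\theta$ is unital and $\theta_t(p)$ increases to $1_{\mathcal{K}}$ as $t\to\infty$. Peripheral spaces. For a quantum dynamical semigroup $\sigma$ on a von Neumann algebra $\mathcal{M}$ and $a\in\mathbb{R}$, $E_a(\sigma)=\{x\in\mathcal{M}:\sigma_t(x)=\exp(iat)x\ \ \forall t\in\mathbb{R}_+\}$; $E(\sigma)$ is the linear span of $\bigcup_{a\in\mathbb{R}}E_a(\sigma)$; $\mathcal{P}(\sigma)$ is the norm closure of $E(\sigma)$. Extended Choi–Effros product. For a quantum Markov semigroup $\tau$ with minimal dilation $\theta$, the compression $z\mapsto pzp$ restricts to a completely isometric bijection of $\mathcal{P}(\theta)$ (a unital $C^*$-subalgebra of $\mathcal{B}$) onto $\mathcal{P}(\tau)$; for $x\in\mathcal{P}(\tau)$ let $\widehat{x}$ be the unique element of $\mathcal{P}(\theta)$ with $p\widehat{x}p=x$. Then $x\circ y:=p\,\widehat{x}\,\widehat{y}\,p$ makes $\mathcal{P}(\tau)$ (with the norm and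 involution of $\mathcal{A}$) a unital $C^*$-algebra, called the peripheral Poisson boundary of $\tau$. *)

theory Defs
  imports "HOL-Analysis.Analysis"
begin

section \<open>Complex Hilbert spaces\<close>

class complex_normed_vector = real_normed_vector +
  fixes scaleC :: "complex \<Rightarrow> 'a \<Rightarrow> 'a" (infixr "*\<^sub>C" 75)
  assumes scaleC_add_right: "c *\<^sub>C (x + y) = c *\<^sub>C x + c *\<^sub>C y"
    and scaleC_add_left: "(c + d) *\<^sub>C x = c *\<^sub>C x + d *\<^sub>C x"
    and scaleC_scaleC: "c *\<^sub>C (d *\<^sub>C x) = (c * d) *\<^sub>C x"
    and scaleC_of_real: "complex_of_real r *\<^sub>C x = r *\<^sub>R x"
    and norm_scaleC: "norm (c *\<^sub>C x) = cmod c * norm x"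

lemma scaleC_one: "1 *\<^sub>C x = (x :: 'a :: complex_normed_vector)"
  using scaleC_of_real[of 1 x] by simp

global_interpretation complex_vector: vector_space "scaleC :: complex \<Rightarrow> 'a \<Rightarrow> 'a :: complex_normed_vector"
  defines csubspace = complex_vector.subspace
    and cspan = complex_vector.span
  by unfold_locales (simp_all add: scaleC_add_right scaleC_add_left scaleC_scaleC scaleC_one)

text \<open>The inner product is conjugate-linear in its first argument.\<close>

class complex_inner = complex_normed_vector +
  fixes cinner :: "'a \<Rightarrow> 'a \<Rightarrow> complex"
  assumes cinner_commute: "cinner x y = cnj (cinner y x)"
    and cinner_add_right: "cinner x (y + z) = cinner x y + cinner x z"
    and cinner_scaleC_right: "cinner x (c *\<^sub>C y) = c * cinner x y"
    and cinner_self: "cinner x x = complex_of_real ((norm x)\<^sup>2)"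

class chilbert_space = complex_inner + complete_space

instantiation complex :: chilbert_space
begin

definition scaleC_complex :: "complex \<Rightarrow> complex \<Rightarrow> complex" where
  "scaleC_complex c x = c * x"

definition cinner_complex :: "complex \<Rightarrow> complex \<Rightarrow> complex" where
  "cinner_complex x y = cnj x * y"

instance
proof
  fix x y z c d :: complex and r :: real
  show "c *\<^sub>C (x + y) = c *\<^sub>C x + c *\<^sub>C y" "(c + d) *\<^sub>C x = c *\<^sub>C x + d *\<^sub>C x"
    "c *\<^sub>C d *\<^sub>C x = (c * d) *\<^sub>C x" "complex_of_real r *\<^sub>C x = r *\<^sub>R x"
    by (simp_all add: scaleC_complex_def distrib_left distrib_right mult.assoc scaleR_conv_of_real)
  show "norm (c *\<^sub>C x) = cmod c * norm x"
    by (simp add: scaleC_complex_def norm_mult)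
  show "cinner x y = cnj (cinner y x)" "cinner x (y + z) = cinner x y + cinner x z"
    "cinner x (c *\<^sub>C y) = c * cinner x y"
    by (simp_all add: scaleC_complex_def cinner_complex_def distrib_left mult.left_commute)
  show "cinner x x = complex_of_real ((norm x)\<^sup>2)"
    unfolding cinner_complex_def complex_norm_square by (rule mult.commute)
qed

end

instantiation blinfun :: (real_normed_vector, complex_normed_vector) complex_normed_vector
begin

definition scaleC_blinfun :: "complex \<Rightarrow> 'a \<Rightarrow>\<^sub>L 'b \<Rightarrow> 'a \<Rightarrow>\<^sub>L 'b" where
  "scaleC_blinfun c T = Blinfun (\<lambda>u. c *\<^sub>C blinfun_apply T u)"

lemma bounded_linear_scaleC_blinfun:
  "bounded_linear (\<lambda>u. c *\<^sub>C blinfun_apply (T :: 'a \<Rightarrow>\<^sub>L 'b) u)"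
proof (rule bounded_linear_intro[where K = "norm T * cmod c"])
  fix x y :: 'a and r :: real
  show "c *\<^sub>C blinfun_apply T (x + y) = c *\<^sub>C blinfun_apply T x + c *\<^sub>C blinfun_apply T y"
    by (simp add: blinfun.add_right scaleC_add_right)
  show "c *\<^sub>C blinfun_apply T (r *\<^sub>R x) = r *\<^sub>R c *\<^sub>C blinfun_apply T x"
    by (simp only: blinfun.scaleR_right scaleC_of_real[symmetric] scaleC_scaleC mult.commute)
  show "norm (c *\<^sub>C blinfun_apply T x) \<le> norm x * (norm T * cmod c)"
    using mult_left_mono[OF norm_blinfun[of T x] norm_ge_zero[of c]]
    by (simp add: norm_scaleC mult_ac)
qed

lemma blinfun_apply_scaleC:
  "blinfun_apply (c *\<^sub>C (T :: 'a \<Rightarrow>\<^sub>L 'b)) u = c *\<^sub>C blinfun_apply T u"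
  unfolding scaleC_blinfun_def
  by (simp add: bounded_linear_Blinfun_apply bounded_linear_scaleC_blinfun)

instance
proof
  fix c d :: complex and r :: real and S T :: "'a \<Rightarrow>\<^sub>L 'b"
  show "c *\<^sub>C (S + T) = c *\<^sub>C S + c *\<^sub>C T"
    by (rule blinfun_eqI) (simp add: blinfun_apply_scaleC blinfun.add_left scaleC_add_right)
  show "(c + d) *\<^sub>C T = c *\<^sub>C T + d *\<^sub>C T"
    by (rule blinfun_eqI) (simp add: blinfun_apply_scaleC blinfun.add_left scaleC_add_left)
  show "c *\<^sub>C d *\<^sub>C T = (c * d) *\<^sub>C T"
    by (rule blinfun_eqI) (simp add: blinfun_apply_scaleC scaleC_scaleC)
  show "complex_of_real r *\<^sub>C T = r *\<^sub>R T"
    by (rule blinfun_eqI) (simp add: blinfun_apply_scaleC blinfun.scaleR_left scaleC_of_real)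
  have le: "norm (c *\<^sub>C T) \<le> cmod c * norm T" for c and T :: "'a \<Rightarrow>\<^sub>L 'b"
  proof (rule norm_blinfun_bound)
    fix u
    show "norm (blinfun_apply (c *\<^sub>C T) u) \<le> cmod c * norm T * norm u"
      using mult_left_mono[OF norm_blinfun[of T u] norm_ge_zero[of c]]
      by (simp add: blinfun_apply_scaleC norm_scaleC mult_ac)
  qed simp
  show "norm (c *\<^sub>C T) = cmod c * norm T"
  proof (cases "c = 0")
    case True
    then show ?thesis using le[of c T] by simp
  next
    case False
    have "inverse c *\<^sub>C c *\<^sub>C T = T"
      by (rule blinfun_eqI) (simp add: blinfun_apply_scaleC scaleC_scaleC scaleC_one False)
    then have "norm T \<le> cmod (inverse c) * norm (c *\<^sub>C T)"
      using le[of "inverse c" "c *\<^sub>C T"] by simp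
    then have "cmod c * norm T \<le> norm (c *\<^sub>C T)"
      using mult_left_mono[OF _ norm_ge_zero[of c]] False
      by (fastforce simp: norm_inverse simp flip: mult.assoc)
    then show ?thesis using le[of c T] by simp
  qed
qed

end

section \<open>Bounded operators\<close>

text \<open>The type \<open>'h \<Rightarrow>\<^sub>L 'k\<close> consists of the bounded real-linear maps;
  \<open>clinear_ops\<close> is its subspace of bounded complex-linear maps.\<close>

definition clinear_ops :: "('h::complex_inner \<Rightarrow>\<^sub>L 'k::complex_inner) set" where
  "clinear_ops = {T. \<forall>c u. blinfun_apply T (c *\<^sub>C u) = c *\<^sub>C blinfun_apply T u}"

definition hadjoint :: "('h::chilbert_space \<Rightarrow>\<^sub>L 'k::chilbert_space) \<Rightarrow> 'k \<Rightarrow>\<^sub>L 'h" where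
  "hadjoint T = (THE S. \<forall>u v. cinner (blinfun_apply S u) v = cinner u (blinfun_apply T v))"

definition positive_op :: "('h::chilbert_space \<Rightarrow>\<^sub>L 'h) \<Rightarrow> bool" where
  "positive_op T \<longleftrightarrow> T \<in> clinear_ops \<and> (\<forall>u. cinner u (blinfun_apply T u) \<in> \<real>\<^sub>\<ge>\<^sub>0)"

definition op_le :: "('h::chilbert_space \<Rightarrow>\<^sub>L 'h) \<Rightarrow> ('h \<Rightarrow>\<^sub>L 'h) \<Rightarrow> bool" where
  "op_le S T \<longleftrightarrow> positive_op (T - S)"

section \<open>Von Neumann algebras and normal completely positive maps\<close>

definition von_neumann_algebra :: "('h::chilbert_space \<Rightarrow>\<^sub>L 'h) set \<Rightarrow> bool" where
  "von_neumann_algebra A \<longleftrightarrow>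
     A \<subseteq> clinear_ops \<and> csubspace A \<and> id_blinfun \<in> A \<and>
     (\<forall>x\<in>A. \<forall>y\<in>A. x o\<^sub>L y \<in> A) \<and> (\<forall>x\<in>A. hadjoint x \<in> A) \<and>
     closedin strong_operator_topology A"

definition generated_von_neumann_algebra ::
    "('h::chilbert_space \<Rightarrow>\<^sub>L 'h) set \<Rightarrow> ('h \<Rightarrow>\<^sub>L 'h) set" where
  "generated_von_neumann_algebra S = \<Inter>{M. von_neumann_algebra M \<and> S \<subseteq> M}"

text \<open>Maps on an algebra \<open>A\<close> are total functions on operators; only their values on \<open>A\<close> matter.\<close>

definition clinear_map_on ::
    "('h::chilbert_space \<Rightarrow>\<^sub>L 'h) set \<Rightarrow> (('h \<Rightarrow>\<^sub>L 'h) \<Rightarrow> 'h \<Rightarrow>\<^sub>L 'h) \<Rightarrow> bool" where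
  "clinear_map_on A \<phi> \<longleftrightarrow>
     (\<forall>x\<in>A. \<phi> x \<in> A) \<and> (\<forall>x\<in>A. \<forall>y\<in>A. \<phi> (x + y) = \<phi> x + \<phi> y) \<and>
     (\<forall>c. \<forall>x\<in>A. \<phi> (c *\<^sub>C x) = c *\<^sub>C \<phi> x)"

text \<open>Positivity of the operator on \<open>H\<^sup>n\<close> given by the matrix \<open>x i j\<close> (\<open>i, j < n\<close>).\<close>

definition positive_op_matrix ::
    "nat \<Rightarrow> (nat \<Rightarrow> nat \<Rightarrow> 'h::chilbert_space \<Rightarrow>\<^sub>L 'h) \<Rightarrow> bool" where
  "positive_op_matrix n x \<longleftrightarrow>
     (\<forall>u. (\<Sum>i<n. cinner (u i) (\<Sum>j<n. blinfun_apply (x i j) (u j))) \<in> \<real>\<^sub>\<ge>\<^sub>0)"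

definition completely_positive_on ::
    "('h::chilbert_space \<Rightarrow>\<^sub>L 'h) set \<Rightarrow> (('h \<Rightarrow>\<^sub>L 'h) \<Rightarrow> 'h \<Rightarrow>\<^sub>L 'h) \<Rightarrow> bool" where
  "completely_positive_on A \<phi> \<longleftrightarrow>
     (\<forall>n x. (\<forall>i<n. \<forall>j<n. x i j \<in> A) \<and> positive_op_matrix n x \<longrightarrow>
        positive_op_matrix n (\<lambda>i j. \<phi> (x i j)))"

definition op_lub_in ::
    "('h::chilbert_space \<Rightarrow>\<^sub>L 'h) set \<Rightarrow> ('h \<Rightarrow>\<^sub>L 'h) set \<Rightarrow> ('h \<Rightarrow>\<^sub>L 'h) \<Rightarrow> bool" where
  "op_lub_in A D s \<longleftrightarrow>
     s \<in> A \<and> hadjoint s = s \<and> (\<forall>d\<in>D. op_le d s) \<and>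
     (\<forall>t\<in>A. hadjoint t = t \<and> (\<forall>d\<in>D. op_le d t) \<longrightarrow> op_le s t)"

text \<open>Normality of a positive map: suprema of bounded upward directed sets of
  self-adjoint elements are preserved.\<close>

definition normal_on ::
    "('h::chilbert_space \<Rightarrow>\<^sub>L 'h) set \<Rightarrow> (('h \<Rightarrow>\<^sub>L 'h) \<Rightarrow> 'h \<Rightarrow>\<^sub>L 'h) \<Rightarrow> bool" where
  "normal_on A \<phi> \<longleftrightarrow>
     (\<forall>D s. D \<subseteq> A \<and> D \<noteq> {} \<and> (\<forall>d\<in>D. hadjoint d = d) \<and>
        (\<forall>d\<in>D. \<forall>e\<in>D. \<exists>f\<in>D. op_le d f \<and> op_le e f) \<and> op_lub_in A D s \<longrightarrow>
        op_lub_in A (\<phi> ` D) (\<phi> s))"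

section \<open>Semigroups\<close>

text \<open>The Hilbert space is the type \<open>'h\<close>; \<open>\<tau> t\<close> is only relevant for \<open>t \<ge> 0\<close>.\<close>

definition quantum_dynamical_semigroup ::
    "('h::chilbert_space \<Rightarrow>\<^sub>L 'h) set \<Rightarrow> (real \<Rightarrow> ('h \<Rightarrow>\<^sub>L 'h) \<Rightarrow> 'h \<Rightarrow>\<^sub>L 'h) \<Rightarrow> bool" where
  "quantum_dynamical_semigroup A \<tau> \<longleftrightarrow>
     separable_space (euclidean :: 'h topology) \<and>
     von_neumann_algebra A \<and>
     (\<forall>t\<ge>0. clinear_map_on A (\<tau> t) \<and> completely_positive_on A (\<tau> t) \<and> normal_on A (\<tau> t)) \<and>
     (\<forall>x\<in>A. \<tau> 0 x = x) \<and>
     (\<forall>s\<ge>0. \<forall>t\<ge>0. \<forall>x\<in>A. \<tau> s (\<tau> t x) = \<tau> (s + t) x) \<and>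
     (\<forall>t\<ge>0. op_le (\<tau> t id_blinfun) id_blinfun) \<and>
     (\<forall>x\<in>A. continuous_map (top_of_set {0..}) strong_operator_topology (\<lambda>t. \<tau> t x))"

definition quantum_markov_semigroup ::
    "('h::chilbert_space \<Rightarrow>\<^sub>L 'h) set \<Rightarrow> (real \<Rightarrow> ('h \<Rightarrow>\<^sub>L 'h) \<Rightarrow> 'h \<Rightarrow>\<^sub>L 'h) \<Rightarrow> bool" where
  "quantum_markov_semigroup A \<tau> \<longleftrightarrow>
     quantum_dynamical_semigroup A \<tau> \<and> (\<forall>t\<ge>0. \<tau> t id_blinfun = id_blinfun)"

definition E_semigroup ::
    "('h::chilbert_space \<Rightarrow>\<^sub>L 'h) set \<Rightarrow> (real \<Rightarrow> ('h \<Rightarrow>\<^sub>L 'h) \<Rightarrow> 'h \<Rightarrow>\<^sub>L 'h) \<Rightarrow> bool" where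
  "E_semigroup B \<theta> \<longleftrightarrow>
     quantum_dynamical_semigroup B \<theta> \<and>
     (\<forall>t\<ge>0. \<forall>x\<in>B. \<forall>y\<in>B. \<theta> t (x o\<^sub>L y) = \<theta> t x o\<^sub>L \<theta> t y) \<and>
     (\<forall>t\<ge>0. \<forall>x\<in>B. \<theta> t (hadjoint x) = hadjoint (\<theta> t x))"

section \<open>Minimal dilations\<close>

text \<open>The inclusion of \<open>H\<close> into \<open>K\<close> is an isometry \<open>J\<close>, so that the projection \<open>p\<close> onto \<open>H\<close>
  is \<open>J J\<^sup>*\<close>. The operator on \<open>K\<close> identified with an operator \<open>x\<close> on \<open>H\<close> is
  \<open>embed J x = J x J\<^sup>*\<close>, and \<open>compress J z = J\<^sup>* z J\<close> is \<open>p z p\<close> read as an operator on \<open>H\<close>.\<close>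

definition isometric_op :: "('h::chilbert_space \<Rightarrow>\<^sub>L 'k::chilbert_space) \<Rightarrow> bool" where
  "isometric_op J \<longleftrightarrow> J \<in> clinear_ops \<and> (\<forall>u. norm (blinfun_apply J u) = norm u)"

definition embed ::
    "('h::chilbert_space \<Rightarrow>\<^sub>L 'k::chilbert_space) \<Rightarrow> ('h \<Rightarrow>\<^sub>L 'h) \<Rightarrow> 'k \<Rightarrow>\<^sub>L 'k" where
  "embed J x = J o\<^sub>L x o\<^sub>L hadjoint J"

definition compress ::
    "('h::chilbert_space \<Rightarrow>\<^sub>L 'k::chilbert_space) \<Rightarrow> ('k \<Rightarrow>\<^sub>L 'k) \<Rightarrow> 'h \<Rightarrow>\<^sub>L 'h" where
  "compress J z = hadjoint J o\<^sub>L z o\<^sub>L J"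

text \<open>The vector \<open>\<theta>\<^bsub>r\<^sub>1\<^esub>(x\<^sub>1) \<dots> \<theta>\<^bsub>r\<^sub>n\<^esub>(x\<^sub>n) u\<close>, for the list of the pairs \<open>(r\<^sub>i, x\<^sub>i)\<close>.\<close>

definition dilation_word ::
    "('h::chilbert_space \<Rightarrow>\<^sub>L 'k::chilbert_space) \<Rightarrow> (real \<Rightarrow> ('k \<Rightarrow>\<^sub>L 'k) \<Rightarrow> 'k \<Rightarrow>\<^sub>L 'k) \<Rightarrow>
      (real \<times> ('h \<Rightarrow>\<^sub>L 'h)) list \<Rightarrow> 'h \<Rightarrow> 'k" where
  "dilation_word J \<theta> w u =
     foldr (\<lambda>(r, x) v. blinfun_apply (\<theta> r (embed J x)) v) w (blinfun_apply J u)"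

text \<open>The inclusion \<open>embed J ` A \<subseteq> B\<close> is implicit in the terms \<open>\<theta>\<^sub>t(x)\<close> with \<open>x \<in> A\<close>.\<close>

definition minimal_dilation ::
    "('h::chilbert_space \<Rightarrow>\<^sub>L 'h) set \<Rightarrow> (real \<Rightarrow> ('h \<Rightarrow>\<^sub>L 'h) \<Rightarrow> 'h \<Rightarrow>\<^sub>L 'h) \<Rightarrow>
     ('h \<Rightarrow>\<^sub>L 'k::chilbert_space) \<Rightarrow>
     ('k \<Rightarrow>\<^sub>L 'k) set \<Rightarrow> (real \<Rightarrow> ('k \<Rightarrow>\<^sub>L 'k) \<Rightarrow> 'k \<Rightarrow>\<^sub>L 'k) \<Rightarrow> bool" where
  "minimal_dilation A \<tau> J B \<theta> \<longleftrightarrow>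
     isometric_op J \<and> E_semigroup B \<theta> \<and>
     embed J ` A \<subseteq> B \<and> compress J ` B = A \<and>
     (\<forall>t\<ge>0. \<forall>x\<in>A. \<tau> t x = compress J (\<theta> t (embed J x))) \<and>
     closure (cspan {dilation_word J \<theta> w u | w u.
        w \<noteq> [] \<and> sorted_wrt (>) (map fst w) \<and> (\<forall>(r, x)\<in>set w. 0 \<le> r \<and> x \<in> A)}) = UNIV \<and>
     B = generated_von_neumann_algebra {\<theta> t (embed J x) | t x. 0 \<le> t \<and> x \<in> A}"

section \<open>Peripheral spaces and the extended Choi--Effros product\<close>

definition peripheral_eigenspace ::
    "('h::chilbert_space \<Rightarrow>\<^sub>L 'h) set \<Rightarrow> (real \<Rightarrow> ('h \<Rightarrow>\<^sub>L 'h) \<Rightarrow> 'h \<Rightarrow>\<^sub>L 'h) \<Rightarrow> real \<Rightarrow>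
      ('h \<Rightarrow>\<^sub>L 'h) set" where
  "peripheral_eigenspace M \<sigma> a =
     {x \<in> M. \<forall>t\<ge>0. \<sigma> t x = exp (\<i> * complex_of_real a * complex_of_real t) *\<^sub>C x}"

definition peripheral_span ::
    "('h::chilbert_space \<Rightarrow>\<^sub>L 'h) set \<Rightarrow> (real \<Rightarrow> ('h \<Rightarrow>\<^sub>L 'h) \<Rightarrow> 'h \<Rightarrow>\<^sub>L 'h) \<Rightarrow>
      ('h \<Rightarrow>\<^sub>L 'h) set" where
  "peripheral_span M \<sigma> = cspan (\<Union>a. peripheral_eigenspace M \<sigma> a)"

definition peripheral_space ::
    "('h::chilbert_space \<Rightarrow>\<^sub>L 'h) set \<Rightarrow> (real \<Rightarrow> ('h \<Rightarrow>\<^sub>L 'h) \<Rightarrow> 'h \<Rightarrow>\<^sub>L 'h) \<Rightarrow>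
      ('h \<Rightarrow>\<^sub>L 'h) set" where
  "peripheral_space M \<sigma> = closure (peripheral_span M \<sigma>)"

definition peripheral_lift ::
    "('h::chilbert_space \<Rightarrow>\<^sub>L 'k::chilbert_space) \<Rightarrow>
     ('k \<Rightarrow>\<^sub>L 'k) set \<Rightarrow> (real \<Rightarrow> ('k \<Rightarrow>\<^sub>L 'k) \<Rightarrow> 'k \<Rightarrow>\<^sub>L 'k) \<Rightarrow> ('h \<Rightarrow>\<^sub>L 'h) \<Rightarrow> 'k \<Rightarrow>\<^sub>L 'k" where
  "peripheral_lift J B \<theta> x = (THE z. z \<in> peripheral_space B \<theta> \<and> compress J z = x)"

definition choi_effros_product ::
    "('h::chilbert_space \<Rightarrow>\<^sub>L 'k::chilbert_space) \<Rightarrow>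
     ('k \<Rightarrow>\<^sub>L 'k) set \<Rightarrow> (real \<Rightarrow> ('k \<Rightarrow>\<^sub>L 'k) \<Rightarrow> 'k \<Rightarrow>\<^sub>L 'k) \<Rightarrow>
     ('h \<Rightarrow>\<^sub>L 'h) \<Rightarrow> ('h \<Rightarrow>\<^sub>L 'h) \<Rightarrow> 'h \<Rightarrow>\<^sub>L 'h" where
  "choi_effros_product J B \<theta> x y =
     compress J (peripheral_lift J B \<theta> x o\<^sub>L peripheral_lift J B \<theta> y)"

end

theory Submission
  imports Defs
begin

text \<open>The theorem holds because the lift of a peripheral eigenvector to the dilation is itself a strong
  limit. Put \<open>X = J x J\<^sup>*\<close> and \<open>p = J J\<^sup>*\<close>. For an eigenvector \<open>x\<close> of \<open>\<tau>\<close> with frequency \<open>a\<close>, the bounded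
  operators \<open>V\<^sub>t = exp(-iat) \<theta>\<^sub>t(X)\<close> satisfy \<open>\<theta>\<^sub>s(p) V\<^sub>t \<theta>\<^sub>s(p) = V\<^sub>s\<close> for \<open>s \<le> t\<close>
  (\<open>rescaled_orbit_compatible\<close>), that is, they form a martingale along the projections \<open>\<theta>\<^sub>s(p)\<close>. These
  projections increase to \<open>1\<close>: they increase because \<open>\<tau>\<close> is Markov (\<open>P_increasing\<close>), and their limit is
  \<open>1\<close> because the dilation is minimal (\<open>P_tendsto_one\<close>). A Pythagoras argument then gives strong
  convergence (\<open>compatible_compressions_converge_strongly\<close>). The limit is an eigenvector of \<open>\<theta>\<close> with the
  same frequency and its compression is \<open>x\<close> (\<open>eigenvector_lift\<close>).

  To identify the limit with the lift of \<open>x\<close> in the definition of the product, one needs that the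
  compression is injective on the norm closed peripheral space of \<open>\<theta>\<close> (\<open>compress_injective\<close>). This
  follows from almost periodicity: by Dirichlet's approximation theorem an orbit \<open>\<theta>\<^sub>t(z)\<close> in this space
  returns close to \<open>z\<close> at arbitrarily late times (\<open>peripheral_space_recurrent\<close>), when \<open>\<theta>\<^sub>t(p)\<close> is
  already above any given \<open>\<theta>\<^sub>s(p)\<close>.

  Finally, \<open>\<theta>\<^sub>t\<close> is multiplicative, so the rescaled \<open>\<tau>\<^sub>t(x y)\<close> is the compression of \<open>V\<^sub>t W\<^sub>t\<close>, where \<open>W\<^sub>t\<close>
  is the rescaled orbit of \<open>y\<close>. As \<open>V\<^sub>t\<close> is bounded, this converges strongly to the compression of the
  product of the lifts.\<close>

section \<open>Complex inner products\<close>

lemma cinner_add_left: "cinner (x + y) z = cinner x z + cinner y (z :: 'a::complex_inner)"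
  unfolding cinner_commute[of "x + y" z] cinner_commute[of x z] cinner_commute[of y z]
  by (simp add: cinner_add_right)

lemma cinner_scaleC_left: "cinner (c *\<^sub>C x) y = cnj c * cinner x (y :: 'a::complex_inner)"
  unfolding cinner_commute[of "c *\<^sub>C x" y] cinner_commute[of x y]
  by (simp add: cinner_scaleC_right)

lemma cinner_minus_right: "cinner x (- y) = - cinner x (y :: 'a::complex_inner)"
  using cinner_scaleC_right[of x "-1" y] by (simp add: scaleC_one)

lemma cinner_minus_left: "cinner (- x) y = - cinner x (y :: 'a::complex_inner)"
  using cinner_scaleC_left[of "-1" x y] by (simp add: scaleC_one)

lemma cinner_diff_right: "cinner x (y - z) = cinner x y - cinner x (z :: 'a::complex_inner)"
  using cinner_add_right[of x y "- z"] by (simp add: cinner_minus_right)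

lemma cinner_diff_left: "cinner (x - y) z = cinner x z - cinner y (z :: 'a::complex_inner)"
  using cinner_add_left[of x "- y" z] by (simp add: cinner_minus_left)

lemma norm_add_square:
  "(norm (x + y))\<^sup>2 = (norm x)\<^sup>2 + (norm y)\<^sup>2 + 2 * Re (cinner x (y :: 'a::complex_inner))"
proof -
  have "complex_of_real ((norm (x + y))\<^sup>2) = cinner (x + y) (x + y)"
    by (simp add: cinner_self)
  also have "\<dots> = complex_of_real ((norm x)\<^sup>2) + complex_of_real ((norm y)\<^sup>2)
      + (cinner x y + cnj (cinner x y))"
    unfolding cinner_self[symmetric] cinner_commute[of y x, symmetric]
    by (simp add: cinner_add_left cinner_add_right)
  finally have "Re (complex_of_real ((norm (x + y))\<^sup>2)) =
      Re (complex_of_real ((norm x)\<^sup>2) + complex_of_real ((norm y)\<^sup>2)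
      + (cinner x y + cnj (cinner x y)))"
    by (rule arg_cong)
  then show ?thesis by simp
qed

lemma norm_diff_square:
  "(norm (x - y))\<^sup>2 = (norm x)\<^sup>2 + (norm y)\<^sup>2 - 2 * Re (cinner x (y :: 'a::complex_inner))"
  using norm_add_square[of x "- y"] by (simp add: cinner_minus_right)

text \<open>The square of the distance from \<open>x\<close> to the complex line spanned by \<open>y\<close>. Its nonnegativity is the
  Cauchy--Schwarz inequality, and in the Riesz theorem it shows that a vector of minimal norm on
  an affine hyperplane is orthogonal to the hyperplane.\<close>

lemma norm_diff_line_projection:
  assumes "y \<noteq> (0 :: 'a::complex_inner)"
  shows "(norm (x - (cinner y x / complex_of_real ((norm y)\<^sup>2)) *\<^sub>C y))\<^sup>2 =
    (norm x)\<^sup>2 - (cmod (cinner y x))\<^sup>2 / (norm y)\<^sup>2"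
proof -
  define c where "c = cinner y x / complex_of_real ((norm y)\<^sup>2)"
  have n0: "(norm y)\<^sup>2 > 0" using assms by simp
  have "cinner x (c *\<^sub>C y) = c * cnj (cinner y x)"
    unfolding cinner_commute[of x y, symmetric] by (rule cinner_scaleC_right)
  also have "\<dots> = complex_of_real ((cmod (cinner y x))\<^sup>2 / (norm y)\<^sup>2)"
    by (simp add: c_def complex_norm_square del: of_real_power)
  finally have r: "Re (cinner x (c *\<^sub>C y)) = (cmod (cinner y x))\<^sup>2 / (norm y)\<^sup>2"
    by (simp del: of_real_divide of_real_power)
  have "cmod c = cmod (cinner y x) / (norm y)\<^sup>2"
    by (simp add: c_def norm_divide norm_power)
  then have "norm (c *\<^sub>C y) = cmod (cinner y x) / norm y"
    using assms by (simp add: norm_scaleC power2_eq_square)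
  then have m: "(norm (c *\<^sub>C y))\<^sup>2 = (cmod (cinner y x))\<^sup>2 / (norm y)\<^sup>2"
    by (simp add: power_divide)
  show ?thesis
    unfolding c_def[symmetric] norm_diff_square r m by simp
qed

lemma cauchy_schwarz: "cmod (cinner x y) \<le> norm x * norm (y :: 'a::complex_inner)"
proof (cases "y = 0")
  case True
  then show ?thesis using cinner_scaleC_right[of x 0 0] by simp
next
  case False
  have "0 \<le> (norm x)\<^sup>2 - (cmod (cinner y x))\<^sup>2 / (norm y)\<^sup>2"
    unfolding norm_diff_line_projection[OF False, symmetric] by simp
  then have "(cmod (cinner y x))\<^sup>2 \<le> (norm x * norm y)\<^sup>2"
    using False by (simp add: field_simps power_mult_distrib)
  then have "cmod (cinner y x) \<le> norm x * norm y"
    by (rule power2_le_imp_le) simp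
  moreover have "cmod (cinner y x) = cmod (cinner x y)"
    unfolding cinner_commute[of y x] by simp
  ultimately show ?thesis by simp
qed

lemma cinner_extensionality:
  assumes "\<And>v. cinner x v = cinner y (v :: 'a::complex_inner)"
  shows "x = y"
  using assms[of "x - y"] cinner_self[of "x - y"] by (simp add: cinner_diff_left)

section \<open>Riesz representation and adjoints\<close>

text \<open>A nonzero bounded functional is represented by a multiple of the vector of minimal norm on
  the hyperplane where it takes the value \<open>1\<close>: that vector is orthogonal to the kernel, and the
  kernel together with the vector spans the space.\<close>

lemma riesz_representation:
  fixes f :: "'a::chilbert_space \<Rightarrow> complex"
  assumes f: "bounded_linear f" and fC: "\<And>c u. f (c *\<^sub>C u) = c * f u"
  obtains w where "\<And>u. f u = cinner w u"
proof (cases "\<exists>v. f v \<noteq> 0")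
  case False
  moreover have "cinner 0 u = 0" for u :: 'a
    using cinner_scaleC_left[of 0 0 u] by simp
  ultimately show ?thesis using that[of 0] by auto
next
  case True
  interpret f: bounded_linear f by fact
  define C where "C = {v. f v = 1}"
  obtain v where v: "f v \<noteq> 0" using True by blast
  have "(1 / f v) *\<^sub>C v \<in> C" using v by (simp add: C_def fC)
  then have ne: "C \<noteq> {}" by blast
  define d where "d = Inf (norm ` C)"
  have bdd: "bdd_below (norm ` C)" by (rule bdd_belowI[of _ 0]) auto
  have dle: "d \<le> norm v" if "v \<in> C" for v
    unfolding d_def using bdd that by (simp add: cInf_lower)
  have d0: "0 \<le> d" unfolding d_def using ne by (intro cInf_greatest) auto
  have "\<exists>v. v \<in> C \<and> norm v < d + 1 / real (Suc n)" for n
  proof -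
    have "Inf (norm ` C) < d + 1 / real (Suc n)" by (simp add: d_def)
    then show ?thesis using ne bdd by (subst (asm) cInf_less_iff) auto
  qed
  then obtain s where sC: "\<And>n. s n \<in> C" and sd: "\<And>n. norm (s n) < d + 1 / real (Suc n)"
    by metis
  have "(\<lambda>n. d + 1 / real (Suc n)) \<longlonglongrightarrow> d + 0"
    by (intro tendsto_intros) (use LIMSEQ_Suc[OF lim_1_over_n] in simp)
  then have sn: "(\<lambda>n. norm (s n)) \<longlonglongrightarrow> d"
    by (intro tendsto_sandwich[of "\<lambda>_. d" "\<lambda>n. norm (s n)" _ "\<lambda>n. d + 1 / real (Suc n)"])
      (use dle[OF sC] less_imp_le[OF sd] in \<open>simp_all del: of_nat_Suc\<close>)
  \<comment> \<open>Midpoints of \<open>C\<close> stay in \<open>C\<close>, so the parallelogram law turns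
    norms close to the minimum into points close to each other.\<close>
  have par: "(norm (s m - s n))\<^sup>2 \<le> 2 * ((norm (s m))\<^sup>2 - d\<^sup>2) + 2 * ((norm (s n))\<^sup>2 - d\<^sup>2)" for m n
  proof -
    have "f ((1/2) *\<^sub>R (s m + s n)) = 1"
      using sC[of m] sC[of n] by (simp add: C_def f.scaleR f.add scaleR_conv_of_real)
    then have "d \<le> norm ((1/2) *\<^sub>R (s m + s n))" by (intro dle) (simp add: C_def)
    then have "2 * d \<le> norm (s m + s n)" by simp
    then have "(2 * d)\<^sup>2 \<le> (norm (s m + s n))\<^sup>2" using d0 by (intro power_mono) auto
    then show ?thesis
      unfolding norm_diff_square norm_add_square by simp
  qed
  have "(\<lambda>n. 2 * ((norm (s n))\<^sup>2 - d\<^sup>2)) \<longlonglongrightarrow> 2 * (d\<^sup>2 - d\<^sup>2)"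
    by (intro tendsto_intros sn)
  then have g0: "(\<lambda>n. 2 * ((norm (s n))\<^sup>2 - d\<^sup>2)) \<longlonglongrightarrow> 0" by simp
  have "Cauchy s"
  proof (rule CauchyI)
    fix e :: real assume "0 < e"
    then have "e\<^sup>2 / 2 > 0" by simp
    from order_tendstoD(2)[OF g0 this] obtain N
      where N: "\<And>n. n \<ge> N \<Longrightarrow> 2 * ((norm (s n))\<^sup>2 - d\<^sup>2) < e\<^sup>2 / 2"
      by (auto simp: eventually_sequentially)
    have "norm (s m - s n) < e" if "m \<ge> N" "n \<ge> N" for m n
    proof -
      have "(norm (s m - s n))\<^sup>2 < e\<^sup>2" using par[of m n] N[OF that(1)] N[OF that(2)] by linarith
      then show ?thesis using \<open>0 < e\<close> by (simp add: power2_less_imp_less)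
    qed
    then show "\<exists>M. \<forall>m\<ge>M. \<forall>n\<ge>M. norm (s m - s n) < e" by blast
  qed
  then obtain w where w: "s \<longlonglongrightarrow> w" using convergent_eq_Cauchy by blast
  have "norm w = d" using tendsto_norm[OF w] sn LIMSEQ_unique by blast
  have "(\<lambda>n. f (s n)) \<longlonglongrightarrow> f w" by (rule f.tendsto[OF w])
  then have fw: "f w = 1" using sC by (simp add: C_def LIMSEQ_const_iff)
  have w0: "norm w \<noteq> 0" using fw f.zero by auto
  have orth: "cinner w u = 0" if u: "f u = 0" for u
  proof (cases "u = 0")
    case True
    then show ?thesis using cinner_scaleC_right[of w 0 0] by simp
  next
    case False
    let ?c = "cinner u w / complex_of_real ((norm u)\<^sup>2)"
    have n0: "(norm u)\<^sup>2 > 0" using False by simp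
    have "f (w - ?c *\<^sub>C u) = 1" by (simp add: f.diff fC fw u)
    then have "norm w \<le> norm (w - ?c *\<^sub>C u)" unfolding \<open>norm w = d\<close> by (intro dle) (simp add: C_def)
    then have "(norm w)\<^sup>2 \<le> (norm (w - ?c *\<^sub>C u))\<^sup>2" by (rule power_mono) simp
    then have "(cmod (cinner u w))\<^sup>2 / (norm u)\<^sup>2 \<le> 0"
      unfolding norm_diff_line_projection[OF False] by simp
    then have "cinner u w = 0" using n0 by (simp add: divide_le_0_iff)
    then show ?thesis using cinner_commute[of w u] by simp
  qed
  have "f u = cinner ((1 / complex_of_real ((norm w)\<^sup>2)) *\<^sub>C w) u" for u
  proof -
    have "cinner w (u - f u *\<^sub>C w) = 0" by (rule orth) (simp add: f.diff fC fw)
    then have "cinner w u = f u * complex_of_real ((norm w)\<^sup>2)"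
      by (simp add: cinner_diff_right cinner_scaleC_right cinner_self)
    then show ?thesis using w0 by (simp add: cinner_scaleC_left)
  qed
  then show ?thesis by (rule that)
qed

lemma cinner_hadjoint_eqI:
  assumes "\<And>u v. cinner (blinfun_apply S u) v = cinner u (blinfun_apply T v)"
  shows "hadjoint T = S"
  unfolding hadjoint_def
proof (rule the_equality)
  fix R assume R: "\<forall>u v. cinner (blinfun_apply R u) v = cinner u (blinfun_apply T v)"
  show "R = S" by (rule blinfun_eqI, rule cinner_extensionality) (simp add: assms R)
qed (simp add: assms)

text \<open>The operator \<open>hadjoint T\<close> is introduced by a definite description. The Riesz theorem, applied to
  the functional \<open>v \<mapsto> \<langle>u, T v\<rangle>\<close> for each \<open>u\<close>, produces the operator that it describes.\<close>

lemma cinner_hadjoint: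
  fixes T :: "'h::chilbert_space \<Rightarrow>\<^sub>L 'k::chilbert_space"
  assumes T: "T \<in> clinear_ops"
  shows "cinner (blinfun_apply (hadjoint T) u) v = cinner u (blinfun_apply T v)"
proof -
  have "\<exists>w. \<forall>v. cinner u (blinfun_apply T v) = cinner w v" for u
  proof -
    have "bounded_linear (\<lambda>v. cinner u (blinfun_apply T v))"
    proof (rule bounded_linear_intro[where K = "norm u * norm T"])
      fix r :: real and v
      show "cinner u (blinfun_apply T (r *\<^sub>R v)) = r *\<^sub>R cinner u (blinfun_apply T v)"
        using cinner_scaleC_right[of u "complex_of_real r" "blinfun_apply T v"]
        by (simp only: blinfun.scaleR_right scaleC_of_real scaleR_conv_of_real)
      show "norm (cinner u (blinfun_apply T v)) \<le> norm v * (norm u * norm T)"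
        using cauchy_schwarz[of u "blinfun_apply T v"]
          mult_left_mono[OF norm_blinfun[of T v] norm_ge_zero[of u]]
        by (simp add: mult_ac)
    qed (simp add: blinfun.add_right cinner_add_right)
    moreover have "cinner u (blinfun_apply T (c *\<^sub>C v)) = c * cinner u (blinfun_apply T v)" for c v
      using T by (simp add: clinear_ops_def cinner_scaleC_right)
    ultimately obtain w where "\<And>v. cinner u (blinfun_apply T v) = cinner w v"
      using riesz_representation[of "\<lambda>v. cinner u (blinfun_apply T v)"] by blast
    then show ?thesis by blast
  qed
  then obtain g where g: "\<And>u v. cinner (g u) v = cinner u (blinfun_apply T v)"
    by metis
  have "bounded_linear g"
  proof (rule bounded_linear_intro[where K = "norm T"])
    fix x y and r :: real
    show "g (x + y) = g x + g y"
      by (rule cinner_extensionality) (simp add: g cinner_add_left)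
    show "g (r *\<^sub>R x) = r *\<^sub>R g x"
      by (rule cinner_extensionality)
        (simp add: g cinner_scaleC_left flip: scaleC_of_real)
    have "(norm (g x))\<^sup>2 = cmod (cinner (g x) (g x))" by (simp add: cinner_self norm_power)
    also have "\<dots> \<le> norm x * norm (blinfun_apply T (g x))"
      unfolding g by (rule cauchy_schwarz)
    also have "\<dots> \<le> norm x * (norm T * norm (g x))"
      by (intro mult_left_mono norm_blinfun) simp
    finally show "norm (g x) \<le> norm x * norm T"
      by (cases "norm (g x) = 0") (auto simp: power2_eq_square mult_ac)
  qed
  then have "hadjoint T = Blinfun g"
    by (intro cinner_hadjoint_eqI) (simp add: bounded_linear_Blinfun_apply g)
  then show ?thesis using \<open>bounded_linear g\<close> by (simp add: bounded_linear_Blinfun_apply g)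
qed

lemma cinner_hadjoint_right:
  fixes T :: "'h::chilbert_space \<Rightarrow>\<^sub>L 'k::chilbert_space"
  assumes "T \<in> clinear_ops"
  shows "cinner v (blinfun_apply (hadjoint T) u) = cinner (blinfun_apply T v) u"
  unfolding cinner_commute[of v] cinner_hadjoint[OF assms] by (rule cinner_commute[symmetric])

lemma scaleC_blinfun_compose: "(c *\<^sub>C S) o\<^sub>L T = c *\<^sub>C (S o\<^sub>L T)"
  by (rule blinfun_eqI) (simp add: blinfun_apply_scaleC)

lemma blinfun_compose_scaleC: "S \<in> clinear_ops \<Longrightarrow> S o\<^sub>L (c *\<^sub>C T) = c *\<^sub>C (S o\<^sub>L T)"
  by (rule blinfun_eqI) (simp add: blinfun_apply_scaleC clinear_ops_def)

lemma id_blinfun_compose: "id_blinfun o\<^sub>L x = x"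
  by (rule blinfun_eqI) simp

lemma blinfun_compose_apply_eq:
  "S o\<^sub>L T = R \<Longrightarrow> blinfun_apply S (blinfun_apply T u) = blinfun_apply R u"
  by auto

section \<open>Strong limits along increasing projections\<close>

lemma limitin_strong_operator_topology_iff:
  "limitin strong_operator_topology f l F \<longleftrightarrow>
     (\<forall>u. ((\<lambda>t. blinfun_apply (f t) u) \<longlongrightarrow> blinfun_apply l u) F)"
proof
  assume "limitin strong_operator_topology f l F"
  note lim = this
  show "\<forall>u. ((\<lambda>t. blinfun_apply (f t) u) \<longlongrightarrow> blinfun_apply l u) F"
  proof (intro allI topological_tendstoI)
    fix u and U :: "'b set" assume U: "open U" "blinfun_apply l u \<in> U"
    have "openin strong_operator_topology {g. \<forall>i\<in>{u}. blinfun_apply g i \<in> U}"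
      using strong_operator_topology_basis[of "{u}" "\<lambda>_. U" "\<lambda>i. i"] U(1) by simp
    from limitinD[OF lim this] show "\<forall>\<^sub>F t in F. blinfun_apply (f t) u \<in> U"
      using U(2) by simp
  qed
next
  assume *: "\<forall>u. ((\<lambda>t. blinfun_apply (f t) u) \<longlongrightarrow> blinfun_apply l u) F"
  have "limitin (product_topology (\<lambda>_. euclidean) UNIV) (\<lambda>t. blinfun_apply (f t)) (blinfun_apply l) F"
    unfolding limitin_componentwise using * by simp
  then have lim: "limitin euclidean (\<lambda>t. blinfun_apply (f t)) (blinfun_apply l) F"
    unfolding euclidean_product_topology .
  show "limitin strong_operator_topology f l F"
    unfolding limitin_def strong_operator_topology_topspace
  proof (intro conjI allI impI)
    fix U assume U: "openin strong_operator_topology U \<and> l \<in> U"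
    then obtain V where V: "openin euclidean V" "U = blinfun_apply -` V"
      by (auto simp: strong_operator_topology_def openin_pullback_topology)
    then have "eventually (\<lambda>t. blinfun_apply (f t) \<in> V) F"
      using U by (intro limitinD[OF lim]) auto
    then show "eventually (\<lambda>t. f t \<in> U) F" using V by simp
  qed simp
qed

lemma convergent_at_top_if_Cauchy:
  fixes f :: "real \<Rightarrow> 'a::complete_space"
  assumes cau: "\<And>e. e > 0 \<Longrightarrow> \<exists>T. \<forall>s\<ge>T. \<forall>t\<ge>T. dist (f s) (f t) < e"
  obtains l where "(f \<longlongrightarrow> l) at_top"
proof -
  have "Cauchy (\<lambda>n. f (real n))"
    unfolding Cauchy_def
  proof (intro allI impI)
    fix e :: real assume "e > 0"
    then obtain T where T: "\<forall>s\<ge>T. \<forall>t\<ge>T. dist (f s) (f t) < e" using cau by blast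
    have "real n \<ge> T" if "n \<ge> nat \<lceil>T\<rceil>" for n using that by linarith
    then show "\<exists>M. \<forall>m\<ge>M. \<forall>n\<ge>M. dist (f (real m)) (f (real n)) < e" using T by blast
  qed
  then obtain l where l: "(\<lambda>n. f (real n)) \<longlonglongrightarrow> l" using convergent_eq_Cauchy by blast
  have "(f \<longlongrightarrow> l) at_top"
  proof (rule tendstoI)
    fix e :: real assume e: "e > 0"
    then obtain T where T: "\<forall>s\<ge>T. \<forall>t\<ge>T. dist (f s) (f t) < e / 2"
      using cau[of "e / 2"] by auto
    obtain N where N: "\<And>n. n \<ge> N \<Longrightarrow> dist (f (real n)) l < e / 2"
      using tendstoD[OF l, of "e / 2"] e by (auto simp: eventually_sequentially)
    define n where "n = max N (nat \<lceil>T\<rceil>)"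
    have n: "n \<ge> N" "real n \<ge> T" unfolding n_def by linarith+
    have "dist (f t) l < e" if "t \<ge> T" for t
    proof -
      have "dist (f t) (f (real n)) < e / 2" using T n(2) that by blast
      then show ?thesis
        using N[OF n(1)] dist_triangle[of "f t" l "f (real n)"] by linarith
    qed
    then show "eventually (\<lambda>t. dist (f t) l < e) at_top"
      unfolding eventually_at_top_linorder by blast
  qed
  then show ?thesis by (rule that)
qed

lemma tendsto_blinfun_apply_strong:
  assumes bound: "\<forall>\<^sub>F t in F. norm (V t) \<le> M"
    and lim: "\<And>u. ((\<lambda>t. blinfun_apply (V t) u) \<longlongrightarrow> blinfun_apply L u) F"
    and w: "(w \<longlongrightarrow> w0) F"
  shows "((\<lambda>t. blinfun_apply (V t) (w t)) \<longlongrightarrow> blinfun_apply L w0) F"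
proof -
  have "((\<lambda>t. blinfun_apply (V t) (w t - w0)) \<longlongrightarrow> 0) F"
  proof (rule Lim_null_comparison)
    show "\<forall>\<^sub>F t in F. norm (blinfun_apply (V t) (w t - w0)) \<le> M * norm (w t - w0)"
      using bound
    proof eventually_elim
      case (elim t)
      then show ?case
        using norm_blinfun[of "V t" "w t - w0"] mult_right_mono[OF elim norm_ge_zero[of "w t - w0"]]
        by linarith
    qed
    have "((\<lambda>t. M * norm (w t - w0)) \<longlongrightarrow> M * norm (w0 - w0)) F"
      by (intro tendsto_intros w)
    then show "((\<lambda>t. M * norm (w t - w0)) \<longlongrightarrow> 0) F" by simp
  qed
  from tendsto_add[OF this lim[of w0]] show ?thesis
    by (simp add: blinfun.diff_right)
qed

definition orthogonal_projection :: "('h::complex_inner \<Rightarrow>\<^sub>L 'h) \<Rightarrow> bool" where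
  "orthogonal_projection P \<longleftrightarrow> (\<forall>u. blinfun_apply P (blinfun_apply P u) = blinfun_apply P u) \<and>
     (\<forall>u v. cinner (blinfun_apply P u) v = cinner u (blinfun_apply P v))"

lemma orthogonal_projection_pythagoras:
  assumes "orthogonal_projection P"
  shows "(norm v)\<^sup>2 = (norm (blinfun_apply P v))\<^sup>2 + (norm (v - blinfun_apply P v))\<^sup>2"
proof -
  have "cinner (blinfun_apply P v) (v - blinfun_apply P v) = 0"
    using assms by (simp add: orthogonal_projection_def cinner_diff_right)
  then show ?thesis
    using norm_add_square[of "blinfun_apply P v" "v - blinfun_apply P v"] by simp
qed

lemma norm_orthogonal_projection_apply_le:
  assumes "orthogonal_projection P"
  shows "norm (blinfun_apply P v) \<le> norm v"
  by (rule power2_le_imp_le) (simp_all add: orthogonal_projection_pythagoras[OF assms, of v])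

lemma norm_orthogonal_projection_le: "orthogonal_projection P \<Longrightarrow> norm P \<le> 1"
  by (rule norm_blinfun_bound) (simp_all add: norm_orthogonal_projection_apply_le)

lemma orthogonal_projection_absorb:
  assumes P: "orthogonal_projection P" and Q: "orthogonal_projection Q"
    and QP: "\<And>u. blinfun_apply Q (blinfun_apply P u) = blinfun_apply P u"
  shows "blinfun_apply P (blinfun_apply Q u) = blinfun_apply P u"
proof (rule cinner_extensionality)
  fix v
  have "cinner (blinfun_apply P (blinfun_apply Q u)) v = cinner u (blinfun_apply Q (blinfun_apply P v))"
    using P Q by (simp add: orthogonal_projection_def)
  then show "cinner (blinfun_apply P (blinfun_apply Q u)) v = cinner (blinfun_apply P u) v"
    using P by (simp add: QP orthogonal_projection_def)
qed

text \<open>An operator martingale: the compressions of the later operators \<open>V t\<close> give back the earlier ones.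
  For \<open>w\<close> in the range of \<open>P s\<close> and \<open>s \<le> r \<le> t\<close> the vector \<open>V r w\<close> is the orthogonal projection of
  \<open>V t w\<close> under \<open>P r\<close>. By Pythagoras, \<open>\<parallel>V t w - V r w\<parallel>\<^sup>2\<close> is the increment of the increasing bounded
  function \<open>t \<mapsto> \<parallel>V t w\<parallel>\<^sup>2\<close>, so the orbit of \<open>w\<close> is Cauchy in norm. Hence the convergence is strong and
  not just weak. It passes from the dense union of the ranges to all vectors by uniform boundedness.\<close>

lemma compatible_compressions_converge_strongly:
  fixes P V :: "real \<Rightarrow> 'h::chilbert_space \<Rightarrow>\<^sub>L 'h"
  assumes proj: "\<And>s. 0 \<le> s \<Longrightarrow> orthogonal_projection (P s)"
    and mono: "\<And>s t u. 0 \<le> s \<Longrightarrow> s \<le> t \<Longrightarrow>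
      blinfun_apply (P t) (blinfun_apply (P s) u) = blinfun_apply (P s) u"
    and one: "\<And>u. ((\<lambda>s. blinfun_apply (P s) u) \<longlongrightarrow> u) at_top"
    and compat: "\<And>s t. 0 \<le> s \<Longrightarrow> s \<le> t \<Longrightarrow> P s o\<^sub>L V t o\<^sub>L P s = V s"
    and bound: "\<And>t. 0 \<le> t \<Longrightarrow> norm (V t) \<le> M"
  obtains L where "\<And>u. ((\<lambda>t. blinfun_apply (V t) u) \<longlongrightarrow> blinfun_apply L u) at_top"
proof -
  have M0: "0 \<le> M" using bound[of 0] norm_ge_zero[of "V 0"] by linarith
  have Vle: "norm (blinfun_apply (V t) u) \<le> M * norm u" if "0 \<le> t" for t u
    using norm_blinfun[of "V t" u] mult_right_mono[OF bound[OF that] norm_ge_zero[of u]] by linarith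
  have step: "norm (blinfun_apply (V t) w - blinfun_apply (V r) w) ^ 2 =
      norm (blinfun_apply (V t) w) ^ 2 - norm (blinfun_apply (V r) w) ^ 2"
    if w: "w = blinfun_apply (P s) u" and st: "0 \<le> s" "s \<le> r" "r \<le> t" for s r t u w
  proof -
    have "blinfun_apply (V r) w = blinfun_apply (P r o\<^sub>L V t o\<^sub>L P r) w"
      using compat[of r t] st by simp
    also have "\<dots> = blinfun_apply (P r) (blinfun_apply (V t) w)"
      using mono[of s r u] st by (simp add: w)
    finally show ?thesis
      using orthogonal_projection_pythagoras[OF proj, of r "blinfun_apply (V t) w"] st by simp
  qed
  have cau_range: "\<exists>T\<ge>0. \<forall>r\<ge>T. \<forall>t\<ge>T. dist (blinfun_apply (V r) w) (blinfun_apply (V t) w) < e"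
    if w: "w = blinfun_apply (P s) u" and s: "0 \<le> s" and e: "0 < e" for s u w e
  proof -
    define n where "n t = (norm (blinfun_apply (V t) w))\<^sup>2" for t
    have nm: "n r \<le> n t" if "s \<le> r" "r \<le> t" for r t
      using step[OF w s that] zero_le_power2[of "norm (blinfun_apply (V t) w - blinfun_apply (V r) w)"]
      unfolding n_def by linarith
    have "n t \<le> (M * norm w)\<^sup>2" if "s \<le> t" for t
      unfolding n_def using Vle[of t w] s that by (intro power_mono) auto
    then have bdd: "bdd_above (n ` {s..})" by (intro bdd_aboveI2) auto
    define S where "S = Sup (n ` {s..})"
    have "S - e\<^sup>2 < S" using e by simp
    then have "\<exists>y\<in>n ` {s..}. S - e\<^sup>2 < y"
      unfolding S_def by (subst less_cSup_iff[OF _ bdd, symmetric]) auto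
    then obtain T where T: "T \<ge> s" "n T > S - e\<^sup>2"
      by auto
    have up: "n t \<le> S" if "t \<ge> s" for t
      unfolding S_def using bdd that by (intro cSup_upper) auto
    have half: "norm (blinfun_apply (V t) w - blinfun_apply (V r) w) < e" if "r \<ge> T" "t \<ge> r" for r t
    proof -
      have "norm (blinfun_apply (V t) w - blinfun_apply (V r) w) ^ 2 = n t - n r"
        unfolding n_def using T that by (intro step[OF w s]) auto
      also have "\<dots> < e\<^sup>2" using up[of t] nm[of T r] T that by linarith
      finally show ?thesis using e by (simp add: power2_less_imp_less)
    qed
    have "dist (blinfun_apply (V r) w) (blinfun_apply (V t) w) < e" if "r \<ge> T" "t \<ge> T" for r t
      using half[of r t] half[of t r] that by (cases "r \<le> t") (auto simp: dist_norm norm_minus_commute)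
    moreover have "T \<ge> 0" using T s by linarith
    ultimately show ?thesis by blast
  qed
  have "\<exists>l. ((\<lambda>t. blinfun_apply (V t) u) \<longlongrightarrow> l) at_top" for u
  proof -
    have cau: "\<exists>T. \<forall>r\<ge>T. \<forall>t\<ge>T. dist (blinfun_apply (V r) u) (blinfun_apply (V t) u) < e"
      if e: "e > 0" for e
    proof -
      have "e / (3 * (M + 1)) > 0" using e M0 by simp
      from eventually_conj[OF eventually_ge_at_top[of 0] tendstoD[OF one this, of u]]
      obtain s where s: "0 \<le> s" "dist (blinfun_apply (P s) u) u < e / (3 * (M + 1))"
        using eventually_happens'[OF trivial_limit_at_top_linorder] by blast
      define w where "w = blinfun_apply (P s) u"
      obtain T where T: "T \<ge> 0"
        "\<forall>r\<ge>T. \<forall>t\<ge>T. dist (blinfun_apply (V r) w) (blinfun_apply (V t) w) < e / 3"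
        using cau_range[OF w_def s(1), of "e / 3"] e by auto
      have app: "dist (blinfun_apply (V t) u) (blinfun_apply (V t) w) < e / 3" if "t \<ge> 0" for t
      proof -
        have "dist (blinfun_apply (V t) u) (blinfun_apply (V t) w) \<le> M * norm (u - w)"
          unfolding dist_norm blinfun.diff_right[symmetric] by (rule Vle[OF that])
        also have "\<dots> \<le> (M + 1) * norm (u - w)" by (intro mult_right_mono) auto
        also have "\<dots> < (M + 1) * (e / (3 * (M + 1)))"
          using s M0 by (intro mult_strict_left_mono) (auto simp: w_def dist_norm norm_minus_commute)
        also have "\<dots> = e / 3" using M0 by (simp add: field_simps)
        finally show ?thesis .
      qed
      have "dist (blinfun_apply (V r) u) (blinfun_apply (V t) u) < e" if "r \<ge> T" "t \<ge> T" for r t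
      proof -
        have "dist (blinfun_apply (V r) w) (blinfun_apply (V t) w) < e / 3" using T that by blast
        then show ?thesis
          using app[of r] app[of t] T(1) that
            dist_triangle[of "blinfun_apply (V r) u" "blinfun_apply (V t) u" "blinfun_apply (V r) w"]
            dist_triangle[of "blinfun_apply (V r) w" "blinfun_apply (V t) u" "blinfun_apply (V t) w"]
          by (simp add: dist_commute)
      qed
      then show ?thesis by blast
    qed
    show ?thesis by (rule convergent_at_top_if_Cauchy[OF cau]) (assumption, rule exI)
  qed
  then obtain g where g: "\<And>u. ((\<lambda>t. blinfun_apply (V t) u) \<longlongrightarrow> g u) at_top"
    using choice[of "\<lambda>u l. ((\<lambda>t. blinfun_apply (V t) u) \<longlongrightarrow> l) at_top"] by blast
  note uniq = tendsto_unique[OF trivial_limit_at_top_linorder g]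
  have "bounded_linear g"
  proof (rule bounded_linear_intro[where K = M])
    fix x y and r :: real
    show "g (x + y) = g x + g y"
      by (rule uniq) (unfold blinfun.add_right, intro tendsto_add g)
    show "g (r *\<^sub>R x) = r *\<^sub>R g x"
      by (rule uniq) (unfold blinfun.scaleR_right, intro tendsto_scaleR tendsto_const g)
    have "\<forall>\<^sub>F t in at_top. norm (blinfun_apply (V t) x) \<le> norm x * M"
      using eventually_ge_at_top[of 0] by eventually_elim (simp add: Vle mult.commute[of "norm x"])
    then show "norm (g x) \<le> norm x * M"
      by (rule tendsto_upperbound[OF tendsto_norm[OF g]]) simp
  qed
  then show ?thesis using that[of "Blinfun g"] g by (simp add: bounded_linear_Blinfun_apply)
qed

text \<open>Equalities between operators in the dilation are checked after compression by \<open>P s\<close> for large \<open>s\<close>,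
  where they become equalities between operators coming from the smaller Hilbert space.\<close>

lemma compressions_determine_operator:
  fixes P :: "real \<Rightarrow> 'h::chilbert_space \<Rightarrow>\<^sub>L 'h"
  assumes proj: "\<And>s. 0 \<le> s \<Longrightarrow> orthogonal_projection (P s)"
    and one: "\<And>u. ((\<lambda>s. blinfun_apply (P s) u) \<longlongrightarrow> u) at_top"
    and eq: "\<And>s. r \<le> s \<Longrightarrow> P s o\<^sub>L S o\<^sub>L P s = P s o\<^sub>L T o\<^sub>L P s"
  shows "S = T"
proof -
  have bound: "\<forall>\<^sub>F s in at_top. norm (P s) \<le> 1"
    using eventually_ge_at_top[of 0] by eventually_elim (simp add: norm_orthogonal_projection_le proj)
  have lim: "((\<lambda>s. blinfun_apply (P s o\<^sub>L R o\<^sub>L P s) u) \<longlongrightarrow> blinfun_apply R u) at_top"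
    for R :: "'h \<Rightarrow>\<^sub>L 'h" and u
    using tendsto_blinfun_apply_strong[OF bound, of id_blinfun,
        OF _ blinfun.tendsto[OF tendsto_const one], of R u] by (simp add: one)
  show ?thesis
  proof (rule blinfun_eqI)
    fix u
    have "\<forall>\<^sub>F s in at_top. blinfun_apply (P s o\<^sub>L S o\<^sub>L P s) u = blinfun_apply (P s o\<^sub>L T o\<^sub>L P s) u"
      using eventually_ge_at_top[of r] by eventually_elim (simp only: eq)
    then have "((\<lambda>s. blinfun_apply (P s o\<^sub>L T o\<^sub>L P s) u) \<longlongrightarrow> blinfun_apply S u) at_top"
      by (rule Lim_transform_eventually[OF lim[of S u]])
    then show "blinfun_apply S u = blinfun_apply T u"
      by (rule tendsto_unique[OF trivial_limit_at_top_linorder _ lim])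
  qed
qed

section \<open>Von Neumann algebras and E-semigroups\<close>

lemma von_neumann_algebra_sum:
  assumes "von_neumann_algebra B" "\<And>i. i \<in> I \<Longrightarrow> f i \<in> B"
  shows "sum f I \<in> B"
  using assms unfolding von_neumann_algebra_def by (intro complex_vector.subspace_sum) auto

lemma von_neumann_algebra_diff:
  assumes "von_neumann_algebra B" "x \<in> B" "y \<in> B"
  shows "x - y \<in> B"
  using assms unfolding von_neumann_algebra_def by (intro complex_vector.subspace_diff) auto

lemma von_neumann_algebra_scaleC:
  assumes "von_neumann_algebra B" "x \<in> B"
  shows "c *\<^sub>C x \<in> B"
  using assms unfolding von_neumann_algebra_def by (intro complex_vector.subspace_scale) auto

lemma von_neumann_algebra_strong_limit:
  assumes B: "von_neumann_algebra B" and F: "F \<noteq> bot" and ev: "\<forall>\<^sub>F t in F. f t \<in> B"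
    and lim: "\<And>u. ((\<lambda>t. blinfun_apply (f t) u) \<longlongrightarrow> blinfun_apply l u) F"
  shows "l \<in> B"
  using B F ev lim unfolding von_neumann_algebra_def
  by (intro limitin_closedin[of strong_operator_topology f l F]) (auto simp: limitin_strong_operator_topology_iff)

lemma von_neumann_algebra_closed:
  assumes "von_neumann_algebra B"
  shows "closed B"
proof -
  have "closedin euclidean {x \<in> topspace euclidean. x \<in> B}"
    using assms unfolding von_neumann_algebra_def
    by (intro closedin_continuous_map_preimage[OF strong_operator_topology_weaker_than_euclidean]) auto
  then show ?thesis by simp
qed

lemma peripheral_space_subset:
  assumes B: "von_neumann_algebra B"
  shows "peripheral_span B \<theta> \<subseteq> B" "peripheral_space B \<theta> \<subseteq> B"
proof -
  have "csubspace B" using B by (simp add: von_neumann_algebra_def)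
  then show *: "peripheral_span B \<theta> \<subseteq> B"
    unfolding peripheral_span_def
    by (intro complex_vector.span_minimal) (auto simp: peripheral_eigenspace_def)
  show "peripheral_space B \<theta> \<subseteq> B"
    unfolding peripheral_space_def by (intro closure_minimal * von_neumann_algebra_closed B)
qed

lemma peripheral_space_diff:
  assumes "x \<in> peripheral_space M \<sigma>" "y \<in> peripheral_space M \<sigma>"
  shows "x - y \<in> peripheral_space M \<sigma>"
proof -
  obtain f g where "\<And>n. f n \<in> peripheral_span M \<sigma>" "f \<longlonglongrightarrow> x" "\<And>n. g n \<in> peripheral_span M \<sigma>" "g \<longlonglongrightarrow> y"
    using assms unfolding peripheral_space_def closure_sequential by metis
  then show ?thesis
    unfolding peripheral_space_def closure_sequential
    by (intro exI[of _ "\<lambda>n. f n - g n"])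
      (auto simp: peripheral_span_def intro: complex_vector.span_diff tendsto_diff)
qed

lemma E_semigroup_facts:
  assumes "E_semigroup B \<theta>"
  shows E_semigroup_algebra: "von_neumann_algebra B"
    and E_semigroup_zero: "x \<in> B \<Longrightarrow> \<theta> 0 x = x"
    and E_semigroup_closed: "0 \<le> t \<Longrightarrow> x \<in> B \<Longrightarrow> \<theta> t x \<in> B"
    and E_semigroup_add: "0 \<le> t \<Longrightarrow> x \<in> B \<Longrightarrow> y \<in> B \<Longrightarrow> \<theta> t (x + y) = \<theta> t x + \<theta> t y"
    and E_semigroup_scaleC: "0 \<le> t \<Longrightarrow> x \<in> B \<Longrightarrow> \<theta> t (c *\<^sub>C x) = c *\<^sub>C \<theta> t x"
    and E_semigroup_compose: "0 \<le> t \<Longrightarrow> x \<in> B \<Longrightarrow> y \<in> B \<Longrightarrow> \<theta> t (x o\<^sub>L y) = \<theta> t x o\<^sub>L \<theta> t y"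
    and E_semigroup_hadjoint: "0 \<le> t \<Longrightarrow> x \<in> B \<Longrightarrow> \<theta> t (hadjoint x) = hadjoint (\<theta> t x)"
    and E_semigroup_semigroup: "0 \<le> s \<Longrightarrow> 0 \<le> t \<Longrightarrow> x \<in> B \<Longrightarrow> \<theta> s (\<theta> t x) = \<theta> (s + t) x"
  using assms unfolding E_semigroup_def quantum_dynamical_semigroup_def clinear_map_on_def by auto

lemma E_semigroup_diff:
  assumes E: "E_semigroup B \<theta>" and t: "0 \<le> t" and x: "x \<in> B" and y: "y \<in> B"
  shows "\<theta> t (x - y) = \<theta> t x - \<theta> t y"
proof -
  have "x - y = x + (-1) *\<^sub>C y" by (simp add: scaleC_one)
  then show ?thesis
    using E_semigroup_add[OF E t x von_neumann_algebra_scaleC[OF E_semigroup_algebra[OF E] y, of "-1"]]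
      E_semigroup_scaleC[OF E t y, of "-1"] by (simp add: scaleC_one)
qed

lemma E_semigroup_map_zero:
  assumes "E_semigroup B \<theta>" and "0 \<le> t"
  shows "\<theta> t 0 = 0"
proof -
  have "0 \<in> B"
    using von_neumann_algebra_sum[OF E_semigroup_algebra[OF assms(1)], of "{}"] by simp
  then show ?thesis using E_semigroup_diff[OF assms, of 0 0] by simp
qed

lemma E_semigroup_sum:
  assumes E: "E_semigroup B \<theta>" and t: "0 \<le> t" and I: "finite I" and f: "\<And>i. i \<in> I \<Longrightarrow> f i \<in> B"
  shows "\<theta> t (sum f I) = (\<Sum>i\<in>I. \<theta> t (f i))"
  using I f
proof (induction I rule: finite_induct)
  case empty
  then show ?case by (simp add: E_semigroup_map_zero[OF E t])
next
  case (insert i I)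
  then show ?case
    by (simp add: E_semigroup_add[OF E t] von_neumann_algebra_sum[OF E_semigroup_algebra[OF E]])
qed

text \<open>A positive contractive map that is multiplicative and preserves adjoints does not increase the
  norm: the operator \<open>\<parallel>x\<parallel>\<^sup>2 1 - x\<^sup>* x\<close> is positive, so is its image, and thus
  \<open>\<parallel>\<theta>\<^sub>t(x) u\<parallel>\<^sup>2 = \<langle>u, \<theta>\<^sub>t(x\<^sup>* x) u\<rangle> \<le> \<parallel>x\<parallel>\<^sup>2 \<langle>u, \<theta>\<^sub>t(1) u\<rangle> \<le> \<parallel>x\<parallel>\<^sup>2 \<parallel>u\<parallel>\<^sup>2\<close>.\<close>

lemma E_semigroup_norm_le:
  assumes E: "E_semigroup B \<theta>" and t: "0 \<le> t" and x: "x \<in> B"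
  shows "norm (\<theta> t x) \<le> norm x"
proof (rule norm_blinfun_bound)
  fix u
  note B = E_semigroup_algebra[OF E]
  have lin: "\<And>y. y \<in> B \<Longrightarrow> y \<in> clinear_ops" and one: "id_blinfun \<in> B"
    and adj: "\<And>y. y \<in> B \<Longrightarrow> hadjoint y \<in> B" and comp: "\<And>y z. y \<in> B \<Longrightarrow> z \<in> B \<Longrightarrow> y o\<^sub>L z \<in> B"
    using B by (auto simp: von_neumann_algebra_def)
  define c where "c = complex_of_real ((norm x)\<^sup>2)"
  define y where "y = c *\<^sub>C id_blinfun - (hadjoint x o\<^sub>L x)"
  have yB: "y \<in> B"
    unfolding y_def by (intro von_neumann_algebra_diff[OF B] von_neumann_algebra_scaleC[OF B] one comp adj x)
  have form: "cinner v (blinfun_apply (hadjoint z o\<^sub>L z) v) = complex_of_real ((norm (blinfun_apply z v))\<^sup>2)"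
    if "z \<in> B" for z v
  proof -
    have "cinner (blinfun_apply (hadjoint z) (blinfun_apply z v)) v = complex_of_real ((norm (blinfun_apply z v))\<^sup>2)"
      unfolding cinner_hadjoint[OF lin[OF that]] by (rule cinner_self)
    then show ?thesis
      using cinner_commute[of v "blinfun_apply (hadjoint z o\<^sub>L z) v"] by simp
  qed
  have pos: "positive_op_matrix 1 (\<lambda>_ _. y)"
    unfolding positive_op_matrix_def
  proof
    fix w :: "nat \<Rightarrow> 'a"
    have "(norm (blinfun_apply x (w 0)))\<^sup>2 \<le> (norm x * norm (w 0))\<^sup>2"
      by (intro power_mono norm_blinfun) simp
    then show "(\<Sum>i<1. cinner (w i) (\<Sum>j<1. blinfun_apply y (w j))) \<in> \<real>\<^sub>\<ge>\<^sub>0"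
      by (simp add: y_def blinfun.diff_left cinner_diff_right form[OF x] blinfun_apply_scaleC
          cinner_scaleC_right cinner_self c_def power_mult_distrib complex_nonneg_Reals_iff
          del: blinfun_apply_blinfun_compose of_real_power flip: of_real_mult of_real_diff)
  qed
  have "completely_positive_on B (\<theta> t)"
    using E t by (simp add: E_semigroup_def quantum_dynamical_semigroup_def)
  then have "positive_op_matrix 1 (\<lambda>_ _. \<theta> t y)"
    using pos yB unfolding completely_positive_on_def by (auto dest!: spec[of _ 1] spec[of _ "\<lambda>_ _. y"])
  then have "cinner u (blinfun_apply (\<theta> t y) u) \<in> \<real>\<^sub>\<ge>\<^sub>0"
    by (auto simp: positive_op_matrix_def dest!: spec[of _ "\<lambda>_. u"])
  moreover have "\<theta> t y = c *\<^sub>C \<theta> t id_blinfun - (hadjoint (\<theta> t x) o\<^sub>L \<theta> t x)"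
    unfolding y_def
    by (simp add: E_semigroup_diff[OF E t] E_semigroup_scaleC[OF E t] E_semigroup_compose[OF E t]
        E_semigroup_hadjoint[OF E t] von_neumann_algebra_scaleC[OF B] one comp adj x)
  ultimately have "(norm (blinfun_apply (\<theta> t x) u))\<^sup>2 \<le> (norm x)\<^sup>2 * Re (cinner u (blinfun_apply (\<theta> t id_blinfun) u))"
    by (simp add: blinfun.diff_left cinner_diff_right form[OF E_semigroup_closed[OF E t x]] blinfun_apply_scaleC
        cinner_scaleC_right c_def complex_nonneg_Reals_iff
        del: blinfun_apply_blinfun_compose of_real_power)
  also have "\<dots> \<le> (norm x)\<^sup>2 * (norm u)\<^sup>2"
  proof (rule mult_left_mono)
    have "positive_op (id_blinfun - \<theta> t id_blinfun)"
      using E t by (simp add: E_semigroup_def quantum_dynamical_semigroup_def op_le_def)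
    then have "cinner u (blinfun_apply (id_blinfun - \<theta> t id_blinfun) u) \<in> \<real>\<^sub>\<ge>\<^sub>0"
      by (simp add: positive_op_def)
    then show "Re (cinner u (blinfun_apply (\<theta> t id_blinfun) u)) \<le> (norm u)\<^sup>2"
      by (simp add: blinfun.diff_left cinner_diff_right cinner_self complex_nonneg_Reals_iff del: of_real_power)
  qed simp
  finally have "(norm (blinfun_apply (\<theta> t x) u))\<^sup>2 \<le> (norm x * norm u)\<^sup>2"
    by (simp add: power_mult_distrib)
  then show "norm (blinfun_apply (\<theta> t x) u) \<le> norm x * norm u"
    by (rule power2_le_imp_le) simp
qed simp

section \<open>Recurrence on the peripheral space\<close>

definition character :: "real \<Rightarrow> real \<Rightarrow> complex" where
  "character a t = exp (\<i> * complex_of_real a * complex_of_real t)"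

lemma character_add: "character a (s + t) = character a s * character a t"
  by (simp add: character_def distrib_left exp_add)

lemma character_zero: "character a 0 = 1"
  by (simp add: character_def)

lemma norm_character: "cmod (character a t) = 1"
  unfolding character_def mult.assoc of_real_mult[symmetric] by (rule norm_exp_i_times)

lemma character_minus: "character (- a) t = inverse (character a t)"
  by (simp add: character_def exp_minus)

lemma character_nonzero: "character a t \<noteq> 0"
  by (simp add: character_def)

text \<open>Finitely many characters of the half-line return simultaneously close to \<open>1\<close> at arbitrarily late
  times, by simultaneous Diophantine approximation of their frequencies.\<close>

lemma characters_recur:
  fixes \<alpha> :: "'a \<Rightarrow> real"
  assumes S: "finite S" and e: "0 < e"
  obtains t where "T \<le> t" "0 \<le> t" "\<And>v. v \<in> S \<Longrightarrow> cmod (character (\<alpha> v) t - 1) < e"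
proof -
  obtain h where h: "bij_betw h {0..<card S} S" using ex_bij_betw_nat_finite[OF S] by blast
  \<comment> \<open>Only integer multiples of \<open>M \<ge> T\<close> are tried, which makes the recurrence time late.\<close>
  define M where "M = max T 1"
  obtain N :: nat where N: "2 * pi / e < real N" using reals_Archimedean2 by blast
  have "0 < 2 * pi / e" using e by simp
  then have N0: "N > 0" using N by (cases N) auto
  obtain q p where q: "0 < q"
    and p: "\<And>i. i < card S \<Longrightarrow> \<bar>of_int q * (M * \<alpha> (h i) / (2 * pi)) - of_int (p i)\<bar> < 1 / N"
    using Dirichlet_approx_simult[OF N0, of "card S" "\<lambda>i. M * \<alpha> (h i) / (2 * pi)"] by metis
  define t where "t = of_int q * M"
  have "1 * M \<le> of_int q * M" using q by (intro mult_right_mono) (auto simp: M_def)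
  then have t: "T \<le> t" "0 \<le> t" unfolding t_def M_def by linarith+
  have "cmod (character (\<alpha> v) t - 1) < e" if "v \<in> S" for v
  proof -
    obtain i where i: "i < card S" "v = h i"
      using h \<open>v \<in> S\<close> by (metis atLeastLessThan_iff bij_betw_def imageE)
    \<comment> \<open>The signed distance of the phase from the nearby full turn, in turns.\<close>
    define \<delta> where "\<delta> = of_int q * (M * \<alpha> (h i) / (2 * pi)) - of_int (p i)"
    have "\<alpha> v * t = 2 * pi * \<delta> + 2 * pi * of_int (p i)"
      by (simp add: \<delta>_def t_def i(2) field_simps)
    then have "character (\<alpha> v) t = exp (\<i> * complex_of_real (2 * pi * \<delta> + 2 * pi * of_int (p i)))"
      by (simp only: character_def mult.assoc of_real_mult[symmetric])
    also have "\<dots> = exp (\<i> * complex_of_real (2 * pi * \<delta>)) * exp (complex_of_real (2 * of_int (p i) * pi) * \<i>)"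
      by (simp add: distrib_left exp_add mult_ac)
    also have "exp (complex_of_real (2 * of_int (p i) * pi) * \<i>) = 1"
      by (rule exp_integer_2pi) simp
    finally have "cmod (character (\<alpha> v) t - 1) = 2 * \<bar>sin (2 * pi * \<delta> / 2)\<bar>"
      using dist_exp_i_1[of "2 * pi * \<delta>"] by simp
    also have "\<dots> \<le> 2 * \<bar>2 * pi * \<delta> / 2\<bar>"
      by (intro mult_left_mono abs_sin_x_le_abs_x) simp
    also have "\<dots> = 2 * pi * \<bar>\<delta>\<bar>" by (simp add: abs_mult)
    also have "\<dots> < 2 * pi * (1 / N)"
      using p[OF i(1)] by (intro mult_strict_left_mono) (auto simp: \<delta>_def)
    also have "\<dots> < e" using N N0 e by (simp add: field_simps)
    finally show ?thesis .
  qed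
  with t show ?thesis by (rule that)
qed

lemma mem_peripheral_eigenspace_iff:
  "x \<in> peripheral_eigenspace M \<sigma> a \<longleftrightarrow> x \<in> M \<and> (\<forall>t\<ge>0. \<sigma> t x = character a t *\<^sub>C x)"
  by (simp add: peripheral_eigenspace_def character_def)

text \<open>On a finite sum of eigenvectors the semigroup acts by a finite set of characters, so late
  recurrence of the characters brings the orbit back close to its starting point.\<close>

lemma peripheral_span_recurrent:
  assumes E: "E_semigroup B \<theta>" and z: "z \<in> peripheral_span B \<theta>" and e: "0 < e"
  obtains t where "T \<le> t" "0 \<le> t" "norm (\<theta> t z - z) < e"
proof -
  note B = E_semigroup_algebra[OF E]
  obtain S r where S: "finite S" "S \<subseteq> (\<Union>a. peripheral_eigenspace B \<theta> a)"
    and zsum: "z = (\<Sum>v\<in>S. r v *\<^sub>C v)"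
    using z unfolding peripheral_span_def complex_vector.span_explicit by blast
  have "\<forall>v\<in>S. \<exists>a. v \<in> peripheral_eigenspace B \<theta> a" using S(2) by blast
  then obtain \<alpha> where \<alpha>: "\<And>v. v \<in> S \<Longrightarrow> v \<in> peripheral_eigenspace B \<theta> (\<alpha> v)" by metis
  \<comment> \<open>The summand \<open>1\<close> keeps \<open>K\<close> positive when the sum is empty.\<close>
  define K where "K = (\<Sum>v\<in>S. norm (r v *\<^sub>C v)) + 1"
  have K: "K > 0" unfolding K_def by (intro add_nonneg_pos sum_nonneg) auto
  obtain t where t: "T \<le> t" "0 \<le> t" and close: "\<And>v. v \<in> S \<Longrightarrow> cmod (character (\<alpha> v) t - 1) < e / K"
    using characters_recur[OF S(1), of "e / K" T \<alpha>] e K by auto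
  have vB: "v \<in> B" and eig: "\<theta> t v = character (\<alpha> v) t *\<^sub>C v" if "v \<in> S" for v
    using \<alpha>[OF that] t(2) by (auto simp: mem_peripheral_eigenspace_iff)
  have "\<theta> t z = (\<Sum>v\<in>S. \<theta> t (r v *\<^sub>C v))"
    unfolding zsum by (intro E_semigroup_sum[OF E t(2) S(1)] von_neumann_algebra_scaleC[OF B] vB)
  also have "\<dots> = (\<Sum>v\<in>S. character (\<alpha> v) t *\<^sub>C r v *\<^sub>C v)"
    by (intro sum.cong refl)
      (simp add: E_semigroup_scaleC[OF E t(2) vB] eig scaleC_scaleC mult.commute)
  finally have "\<theta> t z - z = (\<Sum>v\<in>S. (character (\<alpha> v) t - 1) *\<^sub>C r v *\<^sub>C v)"
    unfolding zsum by (simp add: sum_subtractf left_diff_distrib complex_vector.scale_left_diff_distrib)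
  also have "norm \<dots> \<le> (\<Sum>v\<in>S. e / K * norm (r v *\<^sub>C v))"
    by (intro sum_norm_le, subst norm_scaleC, intro mult_right_mono less_imp_le[OF close]) auto
  also have "\<dots> = e / K * (K - 1)" by (simp add: K_def sum_distrib_left)
  also have "\<dots> < e" using e K by (simp add: field_simps)
  finally show ?thesis using that[OF t] by blast
qed

lemma peripheral_space_recurrent:
  assumes E: "E_semigroup B \<theta>" and z: "z \<in> peripheral_space B \<theta>" and e: "0 < e"
  obtains t where "T \<le> t" "0 \<le> t" "norm (\<theta> t z - z) < e"
proof -
  note sub = peripheral_space_subset[OF E_semigroup_algebra[OF E], of \<theta>]
  have e3: "e / 3 > 0" using e by simp
  obtain z' where z': "z' \<in> peripheral_span B \<theta>" "dist z' z < e / 3"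
    using z e3 unfolding peripheral_space_def closure_approachable by blast
  obtain t where t: "T \<le> t" "0 \<le> t" "norm (\<theta> t z' - z') < e / 3"
    using peripheral_span_recurrent[OF E z'(1) e3] by blast
  have zB: "z \<in> B" "z' \<in> B" using sub z z' by auto
  have "norm (\<theta> t z - \<theta> t z') \<le> norm (z - z')"
    unfolding E_semigroup_diff[OF E t(2) zB, symmetric]
    by (intro E_semigroup_norm_le[OF E t(2)] von_neumann_algebra_diff[OF E_semigroup_algebra[OF E]] zB)
  moreover have "norm (\<theta> t z - z) \<le> norm (\<theta> t z - \<theta> t z') + norm (\<theta> t z' - z') + norm (z' - z)"
    using norm_triangle_ineq[of "\<theta> t z - \<theta> t z' + (\<theta> t z' - z')" "z' - z"]
      norm_triangle_ineq[of "\<theta> t z - \<theta> t z'" "\<theta> t z' - z'"] by simp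
  ultimately have "norm (\<theta> t z - z) < e"
    using t(3) z'(2) by (simp add: dist_norm norm_minus_commute)
  then show ?thesis using that t by blast
qed

section \<open>The minimal dilation of a quantum Markov semigroup\<close>

locale markov_dilation =
  fixes A :: "('h::chilbert_space \<Rightarrow>\<^sub>L 'h) set"
    and \<tau> :: "real \<Rightarrow> ('h \<Rightarrow>\<^sub>L 'h) \<Rightarrow> ('h \<Rightarrow>\<^sub>L 'h)"
    and J :: "'h \<Rightarrow>\<^sub>L 'k::chilbert_space"
    and B :: "('k \<Rightarrow>\<^sub>L 'k) set"
    and \<theta> :: "real \<Rightarrow> ('k \<Rightarrow>\<^sub>L 'k) \<Rightarrow> ('k \<Rightarrow>\<^sub>L 'k)"
  assumes markov: "quantum_markov_semigroup A \<tau>"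
    and dilation: "minimal_dilation A \<tau> J B \<theta>"
begin

lemma E_semigroup_dilation: "E_semigroup B \<theta>"
  using dilation unfolding minimal_dilation_def by (elim conjE)

lemmas von_neumann_B = E_semigroup_algebra[OF E_semigroup_dilation]

lemma von_neumann_A: "von_neumann_algebra A"
  using markov by (simp add: quantum_markov_semigroup_def quantum_dynamical_semigroup_def)

lemma one_A: "id_blinfun \<in> A"
  using von_neumann_A by (simp add: von_neumann_algebra_def)

lemma B_clinear: "z \<in> B \<Longrightarrow> z \<in> clinear_ops"
  using von_neumann_B by (auto simp: von_neumann_algebra_def)

lemma B_compose: "y \<in> B \<Longrightarrow> z \<in> B \<Longrightarrow> y o\<^sub>L z \<in> B"
  using von_neumann_B by (simp add: von_neumann_algebra_def)

lemma embed_B: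
  assumes "x \<in> A"
  shows "embed J x \<in> B"
proof -
  have "embed J ` A \<subseteq> B"
    using dilation unfolding minimal_dilation_def by (elim conjE)
  then show ?thesis using assms by (rule subsetD[OF _ imageI])
qed

lemma J_clinear: "J \<in> clinear_ops" and norm_J: "norm (blinfun_apply J u) = norm u"
  using dilation unfolding minimal_dilation_def isometric_op_def by (elim conjE, simp only:)+

lemma dilates:
  assumes "0 \<le> t" "x \<in> A"
  shows "\<tau> t x = compress J (\<theta> t (embed J x))"
proof -
  have "\<forall>t\<ge>0. \<forall>x\<in>A. \<tau> t x = compress J (\<theta> t (embed J x))"
    using dilation unfolding minimal_dilation_def by (elim conjE)
  then show ?thesis using assms by simp
qed

text \<open>Polarization: the real part is read off from norms of sums, and the imaginary part is a real part
  for \<open>\<i> v\<close> in place of \<open>v\<close>.\<close>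

lemma cinner_J: "cinner (blinfun_apply J u) (blinfun_apply J v) = cinner u v"
proof -
  have re: "Re (cinner (blinfun_apply J u) (blinfun_apply J v)) = Re (cinner u v)" for u v
    using norm_add_square[of "blinfun_apply J u" "blinfun_apply J v"] norm_add_square[of u v]
    by (simp add: norm_J flip: blinfun.add_right)
  have "Im (cinner (blinfun_apply J u) (blinfun_apply J v)) = Im (cinner u v)"
    using re[of u "\<i> *\<^sub>C v"] J_clinear by (simp add: clinear_ops_def cinner_scaleC_right)
  with re show ?thesis by (simp add: complex_eq_iff)
qed

lemma hadjoint_J_J: "blinfun_apply (hadjoint J) (blinfun_apply J u) = u"
  by (rule cinner_extensionality) (simp add: cinner_hadjoint[OF J_clinear] cinner_J)

lemma hadjoint_J_clinear: "hadjoint J \<in> clinear_ops"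
  unfolding clinear_ops_def mem_Collect_eq
  by (intro allI, rule cinner_extensionality)
    (simp add: cinner_hadjoint[OF J_clinear] cinner_scaleC_left)

lemma embed_compose: "embed J x o\<^sub>L embed J y = embed J (x o\<^sub>L y)"
  by (rule blinfun_eqI) (simp add: embed_def hadjoint_J_J)

lemma compress_embed: "compress J (embed J x) = x"
  by (rule blinfun_eqI) (simp add: embed_def compress_def hadjoint_J_J)

lemma embed_scaleC: "embed J (c *\<^sub>C x) = c *\<^sub>C embed J x"
  by (simp add: embed_def scaleC_blinfun_compose blinfun_compose_scaleC[OF J_clinear])

lemma embed_zero: "embed J 0 = 0"
  using embed_scaleC[of 0 0] by simp

text \<open>The projection \<open>\<theta>\<^sub>t(p)\<close>, where \<open>p = J J\<^sup>*\<close> is the projection onto the range of \<open>J\<close>.\<close>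

definition P :: "real \<Rightarrow> 'k \<Rightarrow>\<^sub>L 'k" where
  "P t = \<theta> t (embed J id_blinfun)"

lemma P_B: "0 \<le> t \<Longrightarrow> P t \<in> B"
  unfolding P_def by (intro E_semigroup_closed[OF E_semigroup_dilation] embed_B one_A)

lemma hadjoint_embed_one: "hadjoint (embed J id_blinfun) = embed J id_blinfun"
  by (rule cinner_hadjoint_eqI)
    (simp add: embed_def cinner_hadjoint_right[OF J_clinear] flip: cinner_hadjoint[OF J_clinear])

lemma P_projection:
  assumes t: "0 \<le> t"
  shows "orthogonal_projection (P t)"
  unfolding orthogonal_projection_def
proof (intro conjI allI)
  fix u v
  have "P t o\<^sub>L P t = P t"
    unfolding P_def E_semigroup_compose[OF E_semigroup_dilation t embed_B[OF one_A] embed_B[OF one_A], symmetric]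
      embed_compose id_blinfun_compose ..
  then show "blinfun_apply (P t) (blinfun_apply (P t) u) = blinfun_apply (P t) u"
    by (rule blinfun_compose_apply_eq)
  have "hadjoint (P t) = P t"
    unfolding P_def E_semigroup_hadjoint[OF E_semigroup_dilation t embed_B[OF one_A], symmetric] hadjoint_embed_one ..
  then show "cinner (blinfun_apply (P t) u) v = cinner u (blinfun_apply (P t) v)"
    using cinner_hadjoint[OF B_clinear[OF P_B[OF t]]] by simp
qed

lemma P_zero: "P 0 = embed J id_blinfun"
  unfolding P_def by (rule E_semigroup_zero[OF E_semigroup_dilation embed_B[OF one_A]])

text \<open>This is where the Markov property \<open>\<tau>\<^sub>t(1) = 1\<close> enters. It says that \<open>J\<^sup>* \<theta>\<^sub>t(p) J = 1\<close>, so the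
  projection \<open>\<theta>\<^sub>t(p)\<close> preserves the norm of each vector \<open>J v\<close> and therefore fixes that vector.\<close>

lemma P_fixes_range_J:
  assumes t: "0 \<le> t"
  shows "P t o\<^sub>L P 0 = P 0"
proof (rule blinfun_eqI)
  fix u
  have fix_J: "blinfun_apply (P t) (blinfun_apply J v) = blinfun_apply J v" for v
  proof -
    let ?w = "blinfun_apply J v"
    have "compress J (P t) = id_blinfun"
      using dilates[OF t one_A] markov t by (simp add: P_def quantum_markov_semigroup_def)
    then have "blinfun_apply (compress J (P t)) v = blinfun_apply id_blinfun v"
      by simp
    then have "blinfun_apply (hadjoint J) (blinfun_apply (P t) ?w) = v"
      by (simp add: compress_def)
    then have "cinner (blinfun_apply (P t) ?w) ?w = cinner v v"
      using cinner_hadjoint[OF J_clinear, of "blinfun_apply (P t) ?w" v] by simp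
    moreover have "cinner (blinfun_apply (P t) ?w) ?w = cinner (blinfun_apply (P t) ?w) (blinfun_apply (P t) ?w)"
      using P_projection[OF t] by (simp add: orthogonal_projection_def)
    ultimately have "complex_of_real ((norm (blinfun_apply (P t) ?w))\<^sup>2) = complex_of_real ((norm ?w)\<^sup>2)"
      by (simp only: cinner_self norm_J)
    then have "(norm (blinfun_apply (P t) ?w))\<^sup>2 = (norm ?w)\<^sup>2"
      by (simp only: of_real_eq_iff)
    then show ?thesis
      using orthogonal_projection_pythagoras[OF P_projection[OF t], of ?w] by simp
  qed
  show "blinfun_apply (P t o\<^sub>L P 0) u = blinfun_apply (P 0) u"
    by (simp add: P_zero embed_def fix_J)
qed

lemma P_shift: "0 \<le> s \<Longrightarrow> 0 \<le> t \<Longrightarrow> \<theta> s (P t) = P (s + t)"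
  unfolding P_def by (intro E_semigroup_semigroup[OF E_semigroup_dilation] embed_B one_A)

lemma P_increasing:
  assumes "0 \<le> s" "s \<le> t"
  shows "P t o\<^sub>L P s = P s" "P s o\<^sub>L P t = P s"
proof -
  have t: "0 \<le> t" "0 \<le> t - s" using assms by auto
  have "\<theta> s (P (t - s) o\<^sub>L P 0) = \<theta> s (P 0)"
    by (simp only: P_fixes_range_J[OF t(2)])
  then show *: "P t o\<^sub>L P s = P s"
    using assms t by (simp add: E_semigroup_compose[OF E_semigroup_dilation] P_B P_shift)
  show "P s o\<^sub>L P t = P s"
  proof (rule blinfun_eqI)
    fix u
    have "blinfun_apply (P t) (blinfun_apply (P s) v) = blinfun_apply (P s) v" for v
      using * by (rule blinfun_compose_apply_eq)
    then show "blinfun_apply (P s o\<^sub>L P t) u = blinfun_apply (P s) u"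
      using orthogonal_projection_absorb[OF P_projection[OF assms(1)] P_projection[OF t(1)]] by simp
  qed
qed

lemma embed_absorb: "x \<in> A \<Longrightarrow> P 0 o\<^sub>L embed J x = embed J x"
  unfolding P_zero embed_compose id_blinfun_compose ..

lemma P_fixes_word:
  assumes "0 \<le> r" "x \<in> A"
  shows "P r o\<^sub>L \<theta> r (embed J x) = \<theta> r (embed J x)"
proof -
  have "\<theta> r (P 0 o\<^sub>L embed J x) = \<theta> r (P 0) o\<^sub>L \<theta> r (embed J x)"
    using assms by (simp add: E_semigroup_compose[OF E_semigroup_dilation] P_B embed_B)
  then show ?thesis using assms by (simp add: embed_absorb P_shift)
qed

text \<open>Each vector \<open>\<theta>\<^bsub>r\<^sub>1\<^esub>(x\<^sub>1) \<dots> \<theta>\<^bsub>r\<^sub>n\<^esub>(x\<^sub>n) J u\<close> lies in the range of \<open>\<theta>\<^bsub>r\<^sub>1\<^esub>(p)\<close>, as \<open>p x\<^sub>1 = x\<^sub>1\<close>. So minimality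
  makes the union of the increasing ranges of these projections dense.\<close>

lemma P_tendsto_one: "((\<lambda>t. blinfun_apply (P t) u) \<longlongrightarrow> u) at_top"
proof -
  define R where "R = {u. \<exists>s\<ge>0. blinfun_apply (P s) u = u}"
  have R_mono: "blinfun_apply (P t) u = u" if "0 \<le> s" "s \<le> t" "blinfun_apply (P s) u = u" for s t u
    using blinfun_compose_apply_eq[OF P_increasing(1)[OF that(1,2)], of u] that(3) by simp
  let ?W = "{dilation_word J \<theta> w u | w u.
    w \<noteq> [] \<and> sorted_wrt (>) (map fst w) \<and> (\<forall>(r, x)\<in>set w. 0 \<le> r \<and> x \<in> A)}"
  have "?W \<subseteq> R"
  proof clarify
    fix w :: "(real \<times> ('h \<Rightarrow>\<^sub>L 'h)) list" and u
    assume "w \<noteq> []" and w: "\<forall>(r, x)\<in>set w. 0 \<le> r \<and> x \<in> A"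
    then obtain r x w' where w': "w = (r, x) # w'" by (metis list.exhaust surj_pair)
    then have rx: "0 \<le> r" "x \<in> A" using w by auto
    have "blinfun_apply (P r) (dilation_word J \<theta> w u) = dilation_word J \<theta> w u"
      using blinfun_compose_apply_eq[OF P_fixes_word[OF rx]] by (simp add: dilation_word_def w')
    then show "dilation_word J \<theta> w u \<in> R" using rx by (auto simp: R_def)
  qed
  moreover have "csubspace R"
  proof (rule complex_vector.subspaceI)
    show "0 \<in> R" unfolding R_def by (auto intro!: exI[of _ 0])
    fix c u assume "u \<in> R"
    then obtain s where s: "s \<ge> 0" "blinfun_apply (P s) u = u" by (auto simp: R_def)
    then have "blinfun_apply (P s) (c *\<^sub>C u) = c *\<^sub>C u"
      using B_clinear[OF P_B[OF s(1)]] by (simp add: clinear_ops_def)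
    then show "c *\<^sub>C u \<in> R" using s by (auto simp: R_def)
  next
    fix u v assume "u \<in> R" "v \<in> R"
    then obtain s t where "s \<ge> 0" "blinfun_apply (P s) u = u" "t \<ge> 0" "blinfun_apply (P t) v = v"
      by (auto simp: R_def)
    then have "blinfun_apply (P (max s t)) (u + v) = u + v"
      using R_mono[of s "max s t" u] R_mono[of t "max s t" v] by (simp add: blinfun.add_right)
    then show "u + v \<in> R" using \<open>s \<ge> 0\<close> unfolding R_def by (auto intro!: exI[of _ "max s t"])
  qed
  ultimately have "cspan ?W \<subseteq> R" by (rule complex_vector.span_minimal)
  moreover have "closure (cspan ?W) = UNIV"
    using dilation by (simp add: minimal_dilation_def)
  ultimately have dense: "closure R = UNIV" using closure_mono by blast
  show ?thesis
  proof (rule tendstoI)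
    fix e :: real assume e: "e > 0"
    have "u \<in> closure R" using dense by simp
    then obtain v where "v \<in> R" and v: "dist v u < e / 2"
      using e unfolding closure_approachable by (meson half_gt_zero)
    then obtain s where s: "0 \<le> s" "blinfun_apply (P s) v = v" by (auto simp: R_def)
    have "dist (blinfun_apply (P t) u) u < e" if t: "s \<le> t" for t
    proof -
      have "norm (blinfun_apply (P t) (u - v)) \<le> norm (u - v)"
        using s t by (intro norm_orthogonal_projection_apply_le P_projection) auto
      then have "dist (blinfun_apply (P t) u) v \<le> dist u v"
        using R_mono[OF s(1) t s(2)] by (simp add: dist_norm blinfun.diff_right)
      then show ?thesis
        using v dist_triangle[of "blinfun_apply (P t) u" u v] by (simp add: dist_commute)
    qed
    then show "\<forall>\<^sub>F t in at_top. dist (blinfun_apply (P t) u) u < e"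
      unfolding eventually_at_top_linorder by blast
  qed
qed

lemma compression_P_zero: "P 0 o\<^sub>L z o\<^sub>L P 0 = embed J (compress J z)"
  unfolding P_zero by (rule blinfun_eqI) (simp add: embed_def compress_def)

lemma compression_shift:
  assumes "0 \<le> s" "0 \<le> q" "z \<in> B"
  shows "\<theta> s (P q o\<^sub>L z o\<^sub>L P q) = P (s + q) o\<^sub>L \<theta> s z o\<^sub>L P (s + q)"
  using assms by (simp add: E_semigroup_compose[OF E_semigroup_dilation] B_compose P_B P_shift)

lemma compression_compress:
  assumes "0 \<le> s" "z \<in> B"
  shows "P s o\<^sub>L \<theta> s z o\<^sub>L P s = \<theta> s (embed J (compress J z))"
  using compression_shift[of s 0 z] assms by (simp add: compression_P_zero)

section \<open>Peripheral elements of the dilation\<close>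

text \<open>If \<open>p z p = 0\<close> then \<open>\<theta>\<^sub>t(p) \<theta>\<^sub>t(z) \<theta>\<^sub>t(p) = 0\<close> for all \<open>t\<close>. At late recurrence times \<open>\<theta>\<^sub>t(z)\<close> is close
  to \<open>z\<close>, so the compression of \<open>z\<close> to any \<open>\<theta>\<^sub>s(p) \<le> \<theta>\<^sub>t(p)\<close> is arbitrarily small in norm. Hence it
  vanishes, and so does \<open>z\<close> because \<open>\<theta>\<^sub>s(p)\<close> tends to \<open>1\<close>.\<close>

lemma compress_injective:
  assumes z: "z \<in> peripheral_space B \<theta>" and z0: "compress J z = 0"
  shows "z = 0"
proof (rule compressions_determine_operator[where P = P, OF P_projection P_tendsto_one])
  fix s :: real assume s: "0 \<le> s"
  have zB: "z \<in> B" using z peripheral_space_subset[OF von_neumann_B] by blast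
  have "norm (P s o\<^sub>L z o\<^sub>L P s) \<le> 0 + e" if "0 < e" for e
  proof -
    obtain t where t: "s \<le> t" "0 \<le> t" "norm (\<theta> t z - z) < e"
      using peripheral_space_recurrent[OF E_semigroup_dilation z \<open>0 < e\<close>] by blast
    have "P s o\<^sub>L \<theta> t z o\<^sub>L P s = (P s o\<^sub>L P t) o\<^sub>L \<theta> t z o\<^sub>L (P t o\<^sub>L P s)"
      by (simp only: P_increasing[OF s t(1)])
    also have "\<dots> = P s o\<^sub>L (P t o\<^sub>L \<theta> t z o\<^sub>L P t) o\<^sub>L P s"
      by (rule blinfun_eqI) simp
    also have "\<dots> = 0"
      unfolding compression_compress[OF t(2) zB] z0 embed_zero E_semigroup_map_zero[OF E_semigroup_dilation t(2)]
      by (rule blinfun_eqI) simp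
    finally have zero: "P s o\<^sub>L \<theta> t z o\<^sub>L P s = 0" .
    have "P s o\<^sub>L z o\<^sub>L P s = (P s o\<^sub>L (z - \<theta> t z) o\<^sub>L P s) + (P s o\<^sub>L \<theta> t z o\<^sub>L P s)"
      by (rule blinfun_eqI) (simp add: blinfun.bilinear_simps)
    then have eq: "P s o\<^sub>L z o\<^sub>L P s = P s o\<^sub>L (z - \<theta> t z) o\<^sub>L P s" using zero by simp
    have "norm (P s o\<^sub>L (z - \<theta> t z) o\<^sub>L P s) \<le> norm (P s) * norm (z - \<theta> t z) * norm (P s)"
      by (rule order_trans[OF norm_blinfun_compose mult_right_mono[OF norm_blinfun_compose]]) simp
    also have "\<dots> \<le> 1 * norm (z - \<theta> t z) * 1"
      using norm_orthogonal_projection_le[OF P_projection[OF s]] by (intro mult_mono) auto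
    also have "\<dots> \<le> e" using t(3) by (simp add: norm_minus_commute)
    finally show ?thesis unfolding eq by simp
  qed
  then have "norm (P s o\<^sub>L z o\<^sub>L P s) \<le> 0" by (rule field_le_epsilon)
  then have "P s o\<^sub>L z o\<^sub>L P s = 0" by simp
  also have "0 = P s o\<^sub>L 0 o\<^sub>L P s" by (rule blinfun_eqI) simp
  finally show "P s o\<^sub>L z o\<^sub>L P s = P s o\<^sub>L 0 o\<^sub>L P s" .
qed

lemma rescaled_orbit_norm_le:
  assumes "x \<in> A" "0 \<le> t"
  shows "norm (character (- a) t *\<^sub>C \<theta> t (embed J x)) \<le> norm (embed J x)"
  using E_semigroup_norm_le[OF E_semigroup_dilation assms(2) embed_B[OF assms(1)]] by (simp add: norm_scaleC norm_character)

text \<open>Writing \<open>X = J x J\<^sup>*\<close>, the compression of \<open>\<theta>\<^sub>t(X) = \<theta>\<^sub>s(\<theta>\<^bsub>t-s\<^esub>(X))\<close> by \<open>\<theta>\<^sub>s(p)\<close> is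
  \<open>\<theta>\<^sub>s(p \<theta>\<^bsub>t-s\<^esub>(X) p)\<close>, and \<open>p \<theta>\<^bsub>t-s\<^esub>(X) p\<close> is the copy of \<open>\<tau>\<^bsub>t-s\<^esub>(x)\<close>, which is a multiple of \<open>X\<close>. The
  rescaling by the character cancels the scalar.\<close>

lemma rescaled_orbit_compatible:
  assumes x: "x \<in> peripheral_eigenspace A \<tau> a" and s: "0 \<le> s" and st: "s \<le> t"
  shows "P s o\<^sub>L (character (- a) t *\<^sub>C \<theta> t (embed J x)) o\<^sub>L P s =
    character (- a) s *\<^sub>C \<theta> s (embed J x)"
proof -
  have t: "0 \<le> t - s" using st by simp
  have xA: "x \<in> A" and eig: "\<tau> (t - s) x = character a (t - s) *\<^sub>C x"
    using x t by (auto simp: mem_peripheral_eigenspace_iff)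
  have XB: "embed J x \<in> B" "\<theta> (t - s) (embed J x) \<in> B"
    using xA t by (auto intro: embed_B E_semigroup_closed[OF E_semigroup_dilation])
  have "P s o\<^sub>L \<theta> t (embed J x) o\<^sub>L P s = P s o\<^sub>L \<theta> s (\<theta> (t - s) (embed J x)) o\<^sub>L P s"
    by (simp add: E_semigroup_semigroup[OF E_semigroup_dilation s t XB(1)])
  also have "\<dots> = character a (t - s) *\<^sub>C \<theta> s (embed J x)"
    by (simp add: compression_compress[OF s XB(2)] eig embed_scaleC E_semigroup_scaleC[OF E_semigroup_dilation s XB(1)]
        flip: dilates[OF t xA])
  finally have "P s o\<^sub>L (character (- a) t *\<^sub>C \<theta> t (embed J x)) o\<^sub>L P s =
      (character (- a) t * character a (t - s)) *\<^sub>C \<theta> s (embed J x)"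
    by (simp add: scaleC_blinfun_compose blinfun_compose_scaleC[OF B_clinear[OF P_B[OF s]]])
  also have "character (- a) t * character a (t - s) = character (- a) s"
    using character_add[of "- a" "t - s" s] by (simp add: character_minus character_nonzero)
  finally show ?thesis .
qed

text \<open>The lift of an eigenvector is the strong limit \<open>L\<close> of its rescaled orbit \<open>V\<close> in the dilation. Since
  the compression of \<open>L\<close> by \<open>\<theta>\<^sub>s(p)\<close> is \<open>V s\<close>, the case \<open>s = 0\<close> shows that \<open>L\<close> compresses to \<open>x\<close>, and the
  eigenvector equation for \<open>L\<close> reduces to the semigroup law for the operators \<open>V s\<close>.\<close>

lemma eigenvector_lift:
  assumes x: "x \<in> peripheral_eigenspace A \<tau> a"
  obtains L where "L \<in> peripheral_eigenspace B \<theta> a" "compress J L = x"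
    "\<And>u. ((\<lambda>t. blinfun_apply (character (- a) t *\<^sub>C \<theta> t (embed J x)) u) \<longlongrightarrow> blinfun_apply L u) at_top"
proof -
  define V where "V t = character (- a) t *\<^sub>C \<theta> t (embed J x)" for t
  have xA: "x \<in> A" using x by (simp add: mem_peripheral_eigenspace_iff)
  have XB: "embed J x \<in> B" by (rule embed_B[OF xA])
  have V: "V t \<in> B" if "0 \<le> t" for t
    unfolding V_def using that by (intro von_neumann_algebra_scaleC[OF von_neumann_B] E_semigroup_closed[OF E_semigroup_dilation] XB)
  have compat: "P s o\<^sub>L V t o\<^sub>L P s = V s" if "0 \<le> s" "s \<le> t" for s t
    unfolding V_def by (rule rescaled_orbit_compatible[OF x that])
  have mono: "blinfun_apply (P t) (blinfun_apply (P s) u) = blinfun_apply (P s) u"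
    if "0 \<le> s" "s \<le> t" for s t u
    using P_increasing(1)[OF that] by (rule blinfun_compose_apply_eq)
  obtain L where L: "\<And>u. ((\<lambda>t. blinfun_apply (V t) u) \<longlongrightarrow> blinfun_apply L u) at_top"
    by (rule compatible_compressions_converge_strongly[of P V, OF P_projection mono P_tendsto_one compat
          rescaled_orbit_norm_le[OF xA, of _ a, folded V_def]]) (assumption+, rule that)
  have "\<forall>\<^sub>F t in at_top. V t \<in> B"
    using eventually_ge_at_top[of 0] by eventually_elim (rule V)
  then have LB: "L \<in> B"
    by (rule von_neumann_algebra_strong_limit[OF von_neumann_B trivial_limit_at_top_linorder _ L])
  have comp: "P s o\<^sub>L L o\<^sub>L P s = V s" if s: "0 \<le> s" for s
  proof (rule blinfun_eqI)
    fix u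
    have lim: "((\<lambda>t. blinfun_apply (P s o\<^sub>L V t o\<^sub>L P s) u) \<longlongrightarrow> blinfun_apply (P s o\<^sub>L L o\<^sub>L P s) u) at_top"
      using blinfun.tendsto[OF tendsto_const L] by simp
    have "\<forall>\<^sub>F t in at_top. blinfun_apply (P s o\<^sub>L V t o\<^sub>L P s) u = blinfun_apply (V s) u"
      using eventually_ge_at_top[of s] by eventually_elim (simp only: compat[OF s])
    from tendsto_unique[OF trivial_limit_at_top_linorder lim tendsto_eventually[OF this]]
    show "blinfun_apply (P s o\<^sub>L L o\<^sub>L P s) u = blinfun_apply (V s) u" .
  qed
  have "compress J L = x"
  proof -
    have "embed J (compress J L) = embed J x"
      using comp[of 0] by (simp add: compression_P_zero V_def character_zero scaleC_one E_semigroup_zero[OF E_semigroup_dilation XB])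
    then have "compress J (embed J (compress J L)) = compress J (embed J x)" by simp
    then show ?thesis by (simp only: compress_embed)
  qed
  moreover have "\<theta> s L = character a s *\<^sub>C L" if s: "0 \<le> s" for s
  proof (rule compressions_determine_operator[where P = P and r = s, OF P_projection P_tendsto_one])
    fix r assume r: "s \<le> r"
    then have q: "0 \<le> r - s" and r0: "0 \<le> r" using s by auto
    have "P r o\<^sub>L \<theta> s L o\<^sub>L P r = \<theta> s (V (r - s))"
      using compression_shift[OF s q LB] by (simp add: comp[OF q])
    also have "\<dots> = character (- a) (r - s) *\<^sub>C \<theta> r (embed J x)"
      unfolding V_def
      by (simp add: E_semigroup_scaleC[OF E_semigroup_dilation s] E_semigroup_closed[OF E_semigroup_dilation q XB] E_semigroup_semigroup[OF E_semigroup_dilation s q XB])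
    also have "character (- a) (r - s) = character a s * character (- a) r"
      using character_add[of "- a" "r - s" s] by (simp add: character_minus character_nonzero)
    also have "\<dots> *\<^sub>C \<theta> r (embed J x) = character a s *\<^sub>C (P r o\<^sub>L L o\<^sub>L P r)"
      unfolding comp[OF r0] V_def by simp
    also have "\<dots> = P r o\<^sub>L (character a s *\<^sub>C L) o\<^sub>L P r"
      by (simp add: scaleC_blinfun_compose blinfun_compose_scaleC[OF B_clinear[OF P_B[OF r0]]])
    finally show "P r o\<^sub>L \<theta> s L o\<^sub>L P r = P r o\<^sub>L (character a s *\<^sub>C L) o\<^sub>L P r" .
  qed
  ultimately show ?thesis
    using that[of L] LB L by (simp add: mem_peripheral_eigenspace_iff V_def)
qed

lemma peripheral_lift_eqI:
  assumes L: "L \<in> peripheral_space B \<theta>" and x: "compress J L = x"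
  shows "peripheral_lift J B \<theta> x = L"
  unfolding peripheral_lift_def
proof (rule the_equality)
  fix z assume z: "z \<in> peripheral_space B \<theta> \<and> compress J z = x"
  have "compress J (z - L) = compress J z - compress J L"
    by (rule blinfun_eqI) (simp add: compress_def blinfun.bilinear_simps)
  then have "z - L = 0"
    using z x by (intro compress_injective peripheral_space_diff L) auto
  then show "z = L" by simp
qed (use L x in blast)

text \<open>As \<open>J\<close> is isometric, \<open>J x y J\<^sup>* = (J x J\<^sup>*) (J y J\<^sup>*)\<close>, so multiplicativity of \<open>\<theta>\<^sub>t\<close> turns the rescaled
  \<open>\<tau>\<^sub>t(x y)\<close> into the compression of a product of two rescaled orbits. Both factors converge strongly
  to the lifts and the first one is bounded, so the product converges strongly as well.\<close>

lemma choi_effros_product_limit: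
  assumes x: "x \<in> peripheral_eigenspace A \<tau> a" and y: "y \<in> peripheral_eigenspace A \<tau> b"
  shows "limitin strong_operator_topology
    (\<lambda>t. inverse (character a t * character b t) *\<^sub>C \<tau> t (x o\<^sub>L y)) (choi_effros_product J B \<theta> x y) at_top"
  unfolding limitin_strong_operator_topology_iff
proof
  fix u
  define V where "V t = character (- a) t *\<^sub>C \<theta> t (embed J x)" for t
  define W where "W t = character (- b) t *\<^sub>C \<theta> t (embed J y)" for t
  have xA: "x \<in> A" and yA: "y \<in> A" using x y by (auto simp: mem_peripheral_eigenspace_iff)
  then have xyA: "x o\<^sub>L y \<in> A" using von_neumann_A by (simp add: von_neumann_algebra_def)
  have sub: "peripheral_eigenspace B \<theta> c \<subseteq> peripheral_space B \<theta>" for c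
    unfolding peripheral_space_def peripheral_span_def
    using complex_vector.span_superset closure_subset by fastforce
  obtain K where K: "K \<in> peripheral_eigenspace B \<theta> a" "compress J K = x"
    "\<And>u. ((\<lambda>t. blinfun_apply (V t) u) \<longlongrightarrow> blinfun_apply K u) at_top"
    by (rule eigenvector_lift[OF x, folded V_def]) (rule that)
  obtain L where L: "L \<in> peripheral_eigenspace B \<theta> b" "compress J L = y"
    "\<And>u. ((\<lambda>t. blinfun_apply (W t) u) \<longlongrightarrow> blinfun_apply L u) at_top"
    by (rule eigenvector_lift[OF y, folded W_def]) (rule that)
  have prod: "choi_effros_product J B \<theta> x y = compress J (K o\<^sub>L L)"
    unfolding choi_effros_product_def
      peripheral_lift_eqI[OF subsetD[OF sub K(1)] K(2)] peripheral_lift_eqI[OF subsetD[OF sub L(1)] L(2)] ..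
  have "\<forall>\<^sub>F t in at_top. norm (V t) \<le> norm (embed J x)"
    using eventually_ge_at_top[of 0] unfolding V_def
    by eventually_elim (rule rescaled_orbit_norm_le[OF xA])
  from tendsto_blinfun_apply_strong[OF this K(3) L(3)[of "blinfun_apply J u"]]
  have lim: "((\<lambda>t. blinfun_apply (compress J (V t o\<^sub>L W t)) u) \<longlongrightarrow>
      blinfun_apply (choi_effros_product J B \<theta> x y) u) at_top"
    unfolding prod using blinfun.tendsto[OF tendsto_const] by (simp add: compress_def)
  have "compress J (V t o\<^sub>L W t) = inverse (character a t * character b t) *\<^sub>C \<tau> t (x o\<^sub>L y)"
    if t: "0 \<le> t" for t
  proof -
    have "\<theta> t (embed J x) \<in> clinear_ops"
      by (intro B_clinear E_semigroup_closed[OF E_semigroup_dilation t] embed_B xA)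
    then have "V t o\<^sub>L W t = (character (- a) t * character (- b) t) *\<^sub>C \<theta> t (embed J (x o\<^sub>L y))"
      unfolding V_def W_def embed_compose[symmetric]
        E_semigroup_compose[OF E_semigroup_dilation t embed_B[OF xA] embed_B[OF yA]]
      by (simp add: scaleC_blinfun_compose blinfun_compose_scaleC)
    then show ?thesis
      by (simp add: dilates[OF t xyA] compress_def scaleC_blinfun_compose
          blinfun_compose_scaleC[OF hadjoint_J_clinear] character_minus)
  qed
  then have "\<forall>\<^sub>F t in at_top. blinfun_apply (compress J (V t o\<^sub>L W t)) u =
      blinfun_apply (inverse (character a t * character b t) *\<^sub>C \<tau> t (x o\<^sub>L y)) u"
    by (intro eventually_mono[OF eventually_ge_at_top[of 0]]) simp
  with lim show "((\<lambda>t. blinfun_apply (inverse (character a t * character b t) *\<^sub>C \<tau> t (x o\<^sub>L y)) u) \<longlongrightarrow>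
      blinfun_apply (choi_effros_product J B \<theta> x y) u) at_top"
    by (rule Lim_transform_eventually)
qed

end

theorem theorem4p9:
  fixes A :: "('h::chilbert_space \<Rightarrow>\<^sub>L 'h) set"
    and \<tau> :: "real \<Rightarrow> ('h \<Rightarrow>\<^sub>L 'h) \<Rightarrow> ('h \<Rightarrow>\<^sub>L 'h)"
    and J :: "'h \<Rightarrow>\<^sub>L 'k::chilbert_space"
    and B :: "('k \<Rightarrow>\<^sub>L 'k) set"
    and \<theta> :: "real \<Rightarrow> ('k \<Rightarrow>\<^sub>L 'k) \<Rightarrow> ('k \<Rightarrow>\<^sub>L 'k)"
    and a b :: real
    and x y :: "'h \<Rightarrow>\<^sub>L 'h"
  assumes "quantum_markov_semigroup A \<tau>"
    and "minimal_dilation A \<tau> J B \<theta>"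
    and "x \<in> peripheral_eigenspace A \<tau> a"
    and "y \<in> peripheral_eigenspace A \<tau> b"
  shows "limitin strong_operator_topology
    (\<lambda>t. inverse (exp (\<i> * complex_of_real a * complex_of_real t) *
                  exp (\<i> * complex_of_real b * complex_of_real t)) *\<^sub>C \<tau> t (x o\<^sub>L y))
    (choi_effros_product J B \<theta> x y) at_top"
proof -
  interpret markov_dilation A \<tau> J B \<theta> by unfold_locales fact+
  show ?thesis
    using choi_effros_product_limit[OF assms(3,4)] by (simp only: character_def)
qed

end
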